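(* Let $A\in\mathbb{R}^{m\times n}$, $m\ll n$, have full rank $m$ (so that $AA^*$ is invertible), let $y\in\mathbb{R}^m$ and $\tau>0$. Let the problem $\min\|x\|_{l_1}$ subject to $Ax=y$ have a unique minimizer $\bar x\in\mathbb{R}^n$. Let $(x(t),z(t))$ be the strong solution of $$\frac{dx}{dt}-A^*(z-Ax+y)\in-\tau\,\partial\|x\|_{l_1},\qquad \frac{dz}{dt}=y-Ax,$$ with initial data $x(0)=x_0\in\mathbb{R}^n$, $z(0)=0$. Then for any $\delta>0$ there exists $T=T(\delta)$ such that $$\|x(t)-\bar x\|<\delta\quad\text{for all } t>T.$$ The time $T(\delta)$ depends only on $\delta$, the initial data $x_0$, and $\|AA^*\|$, but not on the dimension $n$.
   Context: $\|\cdot\|$ is the $l_2$ norm of a vector ($\|AA^*\|$ is the norm of the matrix $AA^*$), $\|x\|_{l_1}=\sum_i|x_i|$, and $A^*$ is the (conjugate) transpose of $A$. For $x\in\mathbb{R}^n$ the sub-differential is the set $\partial\|x\|_{l_1}=\mathrm{sgn}(x_1)\times\dots\times\mathrm{sgn}(x_n)\subset\mathbb{R}^n$, where for $s\in\mathbb{R}$ the set $\mathrm{sgn}(s)$ is $\{1\}$ if $s>0$, $\{-1\}$ if $s<0$, and $[-1,1]$ if $s=0$. A pair $(x(t),z(t))$ is a strong solution on a time interval $0\le t\le T'$ if $x(t)$ and $z(t)$ are continuous, differentiable for almost all $t\in[0,T']$, $x(0)=x_0$, $z(0)=0$, and the differential inclusion and the equation for $z$ hold for almost all $t\in[0,T']$.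 The system is accretive in the sense of Crandall and Liggett, and the authors take from the Crandall--Liggett theorems that it has a unique strong solution; this is the solution meant in the claim.
   Formalization: T depending only on δ, x_0 and ‖AA*‖ fails (A=(1 0), x_0=0, τ=1, y→∞). Proved: T depends on δ, ‖x_0‖_1, ‖AA*‖, τ, ‖y‖ and constants (shown to exist) quantifying uniqueness of the minimizer, not on n. Strong solutions are taken absolutely continuous. *)

theory Defs
  imports "HOL-Analysis.Analysis" "Jordan_Normal_Form.DL_Rank"
begin

(* Vectors and matrices carry their dimensions as values, so that one number can be chosen before
   the dimensions are quantified. The names of these types clash with real^'n. *)

unbundle no vec_syntax
unbundle no inner_syntax
hide_type (open) Finite_Cartesian_Product.vec

definition l2_norm :: "real vec \<Rightarrow> real" where
  "l2_norm v = sqrt (v \<bullet> v)"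

definition l1_norm :: "real vec \<Rightarrow> real" where
  "l1_norm v = (\<Sum>i<dim_vec v. \<bar>v $ i\<bar>)"

definition mat_norm :: "real mat \<Rightarrow> real" where
  "mat_norm M = (SUP v \<in> {v \<in> carrier_vec (dim_col M). l2_norm v \<le> 1}. l2_norm (M *\<^sub>v v))"

definition sgn_set :: "real \<Rightarrow> real set" where
  "sgn_set s = (if s > 0 then {1} else if s < 0 then {-1} else {-1..1})"

definition subdiff_l1 :: "real vec \<Rightarrow> real vec set" where
  "subdiff_l1 x = {p \<in> carrier_vec (dim_vec x). \<forall>i<dim_vec x. p $ i \<in> sgn_set (x $ i)}"

definition unique_l1_minimizer :: "real mat \<Rightarrow> real vec \<Rightarrow> real vec \<Rightarrow> bool" where
  "unique_l1_minimizer A y xbar \<longleftrightarrow>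
     (\<forall>v. is_arg_min l1_norm (\<lambda>u. u \<in> carrier_vec (dim_col A) \<and> A *\<^sub>v u = y) v \<longleftrightarrow> v = xbar)"

definition continuous_vec_on :: "real set \<Rightarrow> (real \<Rightarrow> real vec) \<Rightarrow> nat \<Rightarrow> bool" where
  "continuous_vec_on S u d \<longleftrightarrow>
     (\<forall>t\<in>S. u t \<in> carrier_vec d) \<and> (\<forall>i<d. continuous_on S (\<lambda>t. u t $ i))"

definition has_vec_derivative :: "(real \<Rightarrow> real vec) \<Rightarrow> real vec \<Rightarrow> real \<Rightarrow> bool" where
  "has_vec_derivative u u' t \<longleftrightarrow>
     (\<forall>i<dim_vec u'. ((\<lambda>s. u s $ i) has_real_derivative u' $ i) (at t))"

definition abs_continuous_on :: "real set \<Rightarrow> (real \<Rightarrow> real) \<Rightarrow> bool" where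
  "abs_continuous_on S f \<longleftrightarrow>
     (\<forall>\<epsilon>>0. \<exists>\<delta>>0. \<forall>\<D> C. \<D> division_of C \<and> C \<subseteq> S \<and> (\<Sum>K\<in>\<D>. Sup K - Inf K) < \<delta>
        \<longrightarrow> (\<Sum>K\<in>\<D>. \<bar>f (Sup K) - f (Inf K)\<bar>) < \<epsilon>)"

definition abs_continuous_vec_on :: "real set \<Rightarrow> (real \<Rightarrow> real vec) \<Rightarrow> nat \<Rightarrow> bool" where
  "abs_continuous_vec_on S u d \<longleftrightarrow> (\<forall>i<d. abs_continuous_on S (\<lambda>t. u t $ i))"

(* Continuity, differentiability almost everywhere and the equations almost everywhere do not
   determine a solution: a Cantor-type function, with derivative 0 almost everywhere, can be added
   to z. The solution that the Crandall-Liggett theorems provide, and for which uniqueness holds,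
   is Lipschitz; absolute continuity is the weakest usual requirement that singles it out. *)

definition strong_solution_on ::
  "real mat \<Rightarrow> real vec \<Rightarrow> real \<Rightarrow> real vec \<Rightarrow> (real \<Rightarrow> real vec) \<Rightarrow> (real \<Rightarrow> real vec) \<Rightarrow> real \<Rightarrow> bool"
  where
  "strong_solution_on A y \<tau> x0 x z T' \<longleftrightarrow>
     continuous_vec_on {0..T'} x (dim_col A) \<and> continuous_vec_on {0..T'} z (dim_row A) \<and>
     abs_continuous_vec_on {0..T'} x (dim_col A) \<and> abs_continuous_vec_on {0..T'} z (dim_row A) \<and>
     x 0 = x0 \<and> z 0 = 0\<^sub>v (dim_row A) \<and>
     (AE t in lebesgue_on {0..T'}. \<exists>x' \<in> carrier_vec (dim_col A). \<exists>z' \<in> carrier_vec (dim_row A).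
        has_vec_derivative x x' t \<and> has_vec_derivative z z' t \<and>
        x' - A\<^sup>T *\<^sub>v (z t - A *\<^sub>v x t + y) \<in> {(-\<tau>) \<cdot>\<^sub>v p |p. p \<in> subdiff_l1 (x t)} \<and>
        z' = y - A *\<^sub>v x t)"

(* Quantitative form of "xbar is the unique minimizer": the penalty rho makes the constraint exact,
   and kappa is what a competitor at distance at least delta loses, in l1 norm or in the
   constraint. The time after which the solution stays within delta of xbar cannot be bounded
   without it: the minimizers (c,0) and (0,c) for the matrices (1, 1-eps) and (1-eps, 1) and the
   same y stay apart as eps tends to 0, while the two trajectories from the same x0 have the same
   limit on every bounded time interval. *)

definition uniqueness_gap ::
  "real mat \<Rightarrow> real vec \<Rightarrow> real vec \<Rightarrow> real \<Rightarrow> real \<Rightarrow> real \<Rightarrow> bool" where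
  "uniqueness_gap A y xbar \<delta> \<rho> \<kappa> \<longleftrightarrow> \<kappa> > 0 \<and>
     (\<forall>v \<in> carrier_vec (dim_col A).
        l1_norm xbar \<le> l1_norm v + \<rho> * l2_norm (A *\<^sub>v v - y) \<and>
        (\<delta> \<le> l2_norm (v - xbar) \<longrightarrow>
           l1_norm xbar + \<kappa> \<le> l1_norm v + \<rho> * l2_norm (A *\<^sub>v v - y)))"

end

theory Submission
  imports Defs
begin

text \<open>
  Let \<open>q\<close> be a dual certificate: \<open>A\<^sup>T q\<close> is a subgradient of the norm at the minimiser \<open>xb\<close> and
  \<open>|q| \<le> \<rho>\<close>; it exists because \<open>\<rho>\<close> is an exact penalty. Then \<open>(xb, \<tau> q)\<close> is an equilibrium. The flow
  is a contraction, so the distance to this equilibrium does not increase and, comparing a solution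
  with its own time shifts, neither does its speed \<open>|(x', z')|\<close>. An energy
  identity bounds the time integral of the squared speed by a constant \<open>C\<close> that does not involve the
  dimension, hence the squared speed at time \<open>t\<close> is at most \<open>C / t\<close>. The speed controls \<open>|Ax - y|\<close> and,
  multiplied by the distance to the equilibrium, the Bregman distance between \<open>x\<close> and \<open>xb\<close>, so the
  penalised norm exceeds \<open>|xb|\<^sub>1\<close> by \<open>O (1 / sqrt t)\<close>, and the uniqueness gap turns this into closeness.
\<close>

subsection \<open>Absolutely continuous functions\<close>

text \<open>The equations hold only almost everywhere. Instead of integrating, every integrated
  inequality is stated as monotonicity of an absolutely continuous function whose derivative is
  nonpositive off a null set; absolute continuity rules out Cantor-type counterexamples there. The
  final bound, obtained off a null set, reaches every time by continuity. Contraction towards the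
  equilibrium gives no convergence by itself: the squared distance decreases at a rate made of |Ax -
  y|^2 and a Bregman distance, and these need not control |x - xb|. Uniqueness of the minimiser is
  what excludes other limits, so its quantitative form has to set the time. Full rank enters through
  a right inverse of A: it moves any point onto the constraint at a cost proportional to the
  residual, which makes some \<rho> an exact penalty.\<close>

lemma division_of_real_memberE:
  fixes \<D> :: "real set set"
  assumes "\<D> division_of C" "K \<in> \<D>"
  obtains u v where "K = {u..v}" "u \<le> v" "Inf K = u" "Sup K = v" "u \<in> C" "v \<in> C"
proof -
  obtain u v where K: "K = cbox u v" and ne: "K \<noteq> {}" and sub: "K \<subseteq> C"
    using division_ofD(2,3,4)[OF assms(1) assms(2)] by blast
  have uv: "u \<le> v" using K ne by auto
  show thesis
    by (rule that[of u v]) (use K uv sub in auto)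
qed

text \<open>Common source of the closure properties below; two dominating functions are allowed so
  that products are covered.\<close>

lemma abs_continuous_on_dominated:
  assumes f: "abs_continuous_on S f" and g: "abs_continuous_on S g"
    and dom: "\<And>u v. u \<in> S \<Longrightarrow> v \<in> S \<Longrightarrow> \<bar>h v - h u\<bar> \<le> M * (\<bar>f v - f u\<bar> + \<bar>g v - g u\<bar>)"
  shows "abs_continuous_on S h"
  unfolding abs_continuous_on_def
proof (intro allI impI)
  fix \<epsilon> :: real assume \<epsilon>: "\<epsilon> > 0"
  \<comment> \<open>\<open>M\<close> may be zero or negative, while \<open>M'\<close> can be divided
    by.\<close>
  define M' where "M' = \<bar>M\<bar> + 1"
  have M': "M' > 0" unfolding M'_def by linarith
  define \<eta> where "\<eta> = \<epsilon> / (2 * M')"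
  have \<eta>: "\<eta> > 0" using \<epsilon> M' by (simp add: \<eta>_def)
  obtain d1 where d1: "d1 > 0" "\<And>\<D> C. \<D> division_of C \<Longrightarrow> C \<subseteq> S \<Longrightarrow> (\<Sum>K\<in>\<D>. Sup K - Inf K) < d1
        \<Longrightarrow> (\<Sum>K\<in>\<D>. \<bar>f (Sup K) - f (Inf K)\<bar>) < \<eta>"
    using f \<eta> unfolding abs_continuous_on_def by meson
  obtain d2 where d2: "d2 > 0" "\<And>\<D> C. \<D> division_of C \<Longrightarrow> C \<subseteq> S \<Longrightarrow> (\<Sum>K\<in>\<D>. Sup K - Inf K) < d2
        \<Longrightarrow> (\<Sum>K\<in>\<D>. \<bar>g (Sup K) - g (Inf K)\<bar>) < \<eta>"
    using g \<eta> unfolding abs_continuous_on_def by meson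
  show "\<exists>\<delta>>0. \<forall>\<D> C. \<D> division_of C \<and> C \<subseteq> S \<and> (\<Sum>K\<in>\<D>. Sup K - Inf K) < \<delta>
        \<longrightarrow> (\<Sum>K\<in>\<D>. \<bar>h (Sup K) - h (Inf K)\<bar>) < \<epsilon>"
  proof (intro exI[of _ "min d1 d2"] conjI allI impI)
    show "min d1 d2 > 0" using d1 d2 by simp
    fix \<D> C assume a: "\<D> division_of C \<and> C \<subseteq> S \<and> (\<Sum>K\<in>\<D>. Sup K - Inf K) < min d1 d2"
    have "(\<Sum>K\<in>\<D>. \<bar>h (Sup K) - h (Inf K)\<bar>)
        \<le> (\<Sum>K\<in>\<D>. M' * (\<bar>f (Sup K) - f (Inf K)\<bar> + \<bar>g (Sup K) - g (Inf K)\<bar>))"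
    proof (rule sum_mono)
      fix K assume "K \<in> \<D>"
      then obtain u v where "Inf K = u" "Sup K = v" "u \<in> S" "v \<in> S"
        using a division_of_real_memberE by (metis subsetD)
      then have "\<bar>h (Sup K) - h (Inf K)\<bar> \<le> M * (\<bar>f (Sup K) - f (Inf K)\<bar> + \<bar>g (Sup K) - g (Inf K)\<bar>)"
        using dom by simp
      also have "\<dots> \<le> M' * (\<bar>f (Sup K) - f (Inf K)\<bar> + \<bar>g (Sup K) - g (Inf K)\<bar>)"
        by (rule mult_right_mono) (auto simp: M'_def)
      finally show "\<bar>h (Sup K) - h (Inf K)\<bar> \<le> M' * (\<bar>f (Sup K) - f (Inf K)\<bar> + \<bar>g (Sup K) - g (Inf K)\<bar>)" .
    qed
    also have "\<dots> = M' * ((\<Sum>K\<in>\<D>. \<bar>f (Sup K) - f (Inf K)\<bar>) + (\<Sum>K\<in>\<D>. \<bar>g (Sup K) - g (Inf K)\<bar>))"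
      by (simp add: sum_distrib_left[symmetric] sum.distrib)
    also have "\<dots> < M' * (\<eta> + \<eta>)"
      using d1(2)[of \<D> C] d2(2)[of \<D> C] a M' by (intro mult_strict_left_mono add_strict_mono) auto
    also have "\<dots> = \<epsilon>" using M' by (simp add: \<eta>_def)
    finally show "(\<Sum>K\<in>\<D>. \<bar>h (Sup K) - h (Inf K)\<bar>) < \<epsilon>" .
  qed
qed

section \<open>Closure properties of absolute continuity\<close>

lemma abs_continuous_on_const: "abs_continuous_on S (\<lambda>t. c)"
  unfolding abs_continuous_on_def by (auto intro: exI[of _ 1])

lemma abs_continuous_on_ident: "abs_continuous_on S (\<lambda>t. t)"
  unfolding abs_continuous_on_def
proof (intro allI impI)
  fix \<epsilon> :: real assume "\<epsilon> > 0"
  moreover have "(\<Sum>K\<in>\<D>. \<bar>Sup K - Inf K\<bar>) = (\<Sum>K\<in>\<D>. Sup K - Inf K)" if "\<D> division_of C"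
    for \<D> and C :: "real set"
    by (rule sum.cong[OF refl], rule division_of_real_memberE[OF that], assumption) auto
  ultimately show "\<exists>\<delta>>0. \<forall>\<D> C. \<D> division_of C \<and> C \<subseteq> S \<and> (\<Sum>K\<in>\<D>. Sup K - Inf K) < \<delta>
        \<longrightarrow> (\<Sum>K\<in>\<D>. \<bar>Sup K - Inf K\<bar>) < \<epsilon>"
    by metis
qed

lemma abs_continuous_on_add:
  assumes "abs_continuous_on S f" "abs_continuous_on S g"
  shows "abs_continuous_on S (\<lambda>t. f t + g t)"
  by (rule abs_continuous_on_dominated[OF assms, of _ 1]) auto

lemma abs_continuous_on_diff:
  assumes "abs_continuous_on S f" "abs_continuous_on S g"
  shows "abs_continuous_on S (\<lambda>t. f t - g t)"
  by (rule abs_continuous_on_dominated[OF assms, of _ 1]) auto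

lemma abs_continuous_on_abs:
  assumes "abs_continuous_on S f"
  shows "abs_continuous_on S (\<lambda>t. \<bar>f t\<bar>)"
proof (rule abs_continuous_on_dominated[OF assms assms, of _ 1])
  fix u v
  show "\<bar>\<bar>f v\<bar> - \<bar>f u\<bar>\<bar> \<le> 1 * (\<bar>f v - f u\<bar> + \<bar>f v - f u\<bar>)"
    by (rule order_trans[OF abs_triangle_ineq3]) simp
qed

lemma abs_continuous_on_sum:
  assumes "\<And>i. i \<in> I \<Longrightarrow> abs_continuous_on S (f i)"
  shows "abs_continuous_on S (\<lambda>t. \<Sum>i\<in>I. f i t)"
  using assms
  by (induction I rule: infinite_finite_induct)
    (auto intro: abs_continuous_on_const abs_continuous_on_add)

text \<open>A single interval is already a division, and for it the definition is uniform
  continuity.\<close>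

lemma abs_continuous_on_imp_continuous_on:
  assumes "abs_continuous_on {a..b} f"
  shows "continuous_on {a..b} f"
  unfolding continuous_on_iff
proof (intro ballI allI impI)
  fix s \<epsilon> :: real assume s: "s \<in> {a..b}" and \<epsilon>: "\<epsilon> > 0"
  obtain d where d: "d > 0" "\<And>\<D> C. \<D> division_of C \<Longrightarrow> C \<subseteq> {a..b} \<Longrightarrow> (\<Sum>K\<in>\<D>. Sup K - Inf K) < d
        \<Longrightarrow> (\<Sum>K\<in>\<D>. \<bar>f (Sup K) - f (Inf K)\<bar>) < \<epsilon>"
    using assms \<epsilon> unfolding abs_continuous_on_def by meson
  have *: "\<bar>f v - f u\<bar> < \<epsilon>" if "u \<le> v" "u \<in> {a..b}" "v \<in> {a..b}" "v - u < d" for u v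
    using d(2)[of "{{u..v}}" "{u..v}"] division_of_self[of u v] that by auto
  have "dist (f t) (f s) < \<epsilon>" if "t \<in> {a..b}" "dist t s < d" for t
    using *[of s t] *[of t s] s that by (cases "s \<le> t") (auto simp: dist_real_def)
  then show "\<exists>d>0. \<forall>t\<in>{a..b}. dist t s < d \<longrightarrow> dist (f t) (f s) < \<epsilon>"
    using d(1) by blast
qed

lemma abs_continuous_on_mult:
  assumes f: "abs_continuous_on {a..b} f" and g: "abs_continuous_on {a..b} g"
  shows "abs_continuous_on {a..b} (\<lambda>t. f t * g t)"
proof -
  have "bounded (f ` {a..b})" "bounded (g ` {a..b})"
    using assms by (auto intro!: compact_imp_bounded compact_continuous_image
        abs_continuous_on_imp_continuous_on)
  then obtain F G where F: "\<forall>t\<in>{a..b}. \<bar>f t\<bar> \<le> F" and G: "\<forall>t\<in>{a..b}. \<bar>g t\<bar> \<le> G"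
    unfolding bounded_real by blast
  show ?thesis
  proof (rule abs_continuous_on_dominated[OF f g, of _ "max F G"])
    fix u v assume u: "u \<in> {a..b}" and v: "v \<in> {a..b}"
    have "\<bar>f v * g v - f u * g u\<bar> = \<bar>(f v - f u) * g v + f u * (g v - g u)\<bar>"
      by (simp add: algebra_simps)
    also have "\<dots> \<le> \<bar>f v - f u\<bar> * \<bar>g v\<bar> + \<bar>f u\<bar> * \<bar>g v - g u\<bar>"
      by (metis abs_mult abs_triangle_ineq)
    also have "\<dots> \<le> \<bar>f v - f u\<bar> * max F G + max F G * \<bar>g v - g u\<bar>"
      using bspec[OF F u] bspec[OF G v] by (intro add_mono mult_left_mono mult_right_mono) auto
    finally show "\<bar>f v * g v - f u * g u\<bar> \<le> max F G * (\<bar>f v - f u\<bar> + \<bar>g v - g u\<bar>)"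
      by (simp add: algebra_simps)
  qed
qed

lemma abs_continuous_on_power2:
  assumes "abs_continuous_on {a..b} f"
  shows "abs_continuous_on {a..b} (\<lambda>t. (f t)\<^sup>2)"
  using abs_continuous_on_mult[OF assms assms] by (simp add: power2_eq_square)

lemma abs_continuous_on_subset:
  assumes "abs_continuous_on S f" "R \<subseteq> S"
  shows "abs_continuous_on R f"
  using assms unfolding abs_continuous_on_def by (meson subset_trans)

lemma division_of_translate:
  fixes \<D> :: "real set set"
  assumes "\<D> division_of C"
  shows "(`) ((+) h) ` \<D> division_of (+) h ` C"
proof (rule division_ofI)
  note D = division_ofD[OF assms]
  show "finite ((`) ((+) h) ` \<D>)" using D(1) by simp
  show "\<Union> ((`) ((+) h) ` \<D>) = (+) h ` C" using D(6) by blast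
  fix K assume "K \<in> (`) ((+) h) ` \<D>"
  then obtain L where L: "L \<in> \<D>" "K = (+) h ` L" by blast
  show "K \<subseteq> (+) h ` C" "K \<noteq> {}" using L D(2,3) by blast+
  obtain u v where "L = cbox u v" using D(4) L by blast
  then show "\<exists>a b. K = cbox a b" using L(2) by auto
  fix K' assume "K' \<in> (`) ((+) h) ` \<D>" "K \<noteq> K'"
  then obtain L' where L': "L' \<in> \<D>" "K' = (+) h ` L'" "L \<noteq> L'" using L by blast
  have "interior K \<inter> interior K' = (+) h ` (interior L \<inter> interior L')"
    using L(2) L'(2) by (simp add: interior_translation translation_Int)
  then show "interior K \<inter> interior K' = {}" using D(5) L L' by simp
qed

text \<open>Needed to compare a solution with its own time shifts; translating a division preserves
  the lengths in it.\<close>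

lemma abs_continuous_on_shift:
  assumes "abs_continuous_on {a + h..b + h} f"
  shows "abs_continuous_on {a..b} (\<lambda>t. f (t + h))"
  unfolding abs_continuous_on_def
proof (intro allI impI)
  fix \<epsilon> :: real assume "\<epsilon> > 0"
  have "\<exists>d>0. \<forall>\<D> C. \<D> division_of C \<and> C \<subseteq> {a+h..b+h} \<and> (\<Sum>K\<in>\<D>. Sup K - Inf K) < d
        \<longrightarrow> (\<Sum>K\<in>\<D>. \<bar>f (Sup K) - f (Inf K)\<bar>) < \<epsilon>"
    by (rule assms[unfolded abs_continuous_on_def, THEN spec, THEN mp]) fact
  then obtain d where d0: "d > 0" and d1: "\<forall>\<D> C. \<D> division_of C \<and> C \<subseteq> {a+h..b+h} \<and> (\<Sum>K\<in>\<D>. Sup K - Inf K) < d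
        \<longrightarrow> (\<Sum>K\<in>\<D>. \<bar>f (Sup K) - f (Inf K)\<bar>) < \<epsilon>"
    by (elim exE conjE)
  show "\<exists>\<delta>>0. \<forall>\<D> C. \<D> division_of C \<and> C \<subseteq> {a..b} \<and> (\<Sum>K\<in>\<D>. Sup K - Inf K) < \<delta>
        \<longrightarrow> (\<Sum>K\<in>\<D>. \<bar>f (Sup K + h) - f (Inf K + h)\<bar>) < \<epsilon>"
  proof (intro exI[of _ d] conjI allI impI)
    fix \<D> C assume A: "\<D> division_of C \<and> C \<subseteq> {a..b} \<and> (\<Sum>K\<in>\<D>. Sup K - Inf K) < d"
    have SI: "Sup ((+) h ` K) = Sup K + h" "Inf ((+) h ` K) = Inf K + h" if K: "K \<in> \<D>" for K
    proof -
      obtain u v where "K = {u..v}" "u \<le> v"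
        by (rule division_of_real_memberE[OF conjunct1[OF A] K])
      then show "Sup ((+) h ` K) = Sup K + h" "Inf ((+) h ` K) = Inf K + h" by auto
    qed
    have inj: "inj_on ((`) ((+) h)) \<D>"
      by (rule inj_onI) (simp add: inj_image_eq_iff)
    have "(\<Sum>K\<in>(`) ((+) h) ` \<D>. \<bar>f (Sup K) - f (Inf K)\<bar>) < \<epsilon>"
    proof (rule d1[rule_format], intro conjI)
      show "(`) ((+) h) ` \<D> division_of (+) h ` C" using A division_of_translate by blast
      show "(+) h ` C \<subseteq> {a+h..b+h}" using A by auto
      show "(\<Sum>K\<in>(`) ((+) h) ` \<D>. Sup K - Inf K) < d"
        using A by (simp add: sum.reindex[OF inj] SI)
    qed
    then show "(\<Sum>K\<in>\<D>. \<bar>f (Sup K + h) - f (Inf K + h)\<bar>) < \<epsilon>"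
      by (simp add: sum.reindex[OF inj] SI)
  qed (rule d0)
qed

text \<open>Cousin's lemma: on a fine tagged division the intervals tagged outside \<open>N\<close> contribute at
  most \<open>\<epsilon> * (b - a)\<close>, and those tagged in \<open>N\<close> lie in an open set of small measure, where absolute
  continuity applies.\<close>

lemma abs_continuous_on_nonincreasing:
  assumes ac: "abs_continuous_on {a..b} f" and ab: "a \<le> b" and N: "negligible N"
    and deriv: "\<And>t. t \<in> {a..b} - N \<Longrightarrow> \<exists>D\<le>0. (f has_real_derivative D) (at t)"
  shows "f b \<le> f a"
proof (rule field_le_epsilon)
  fix e :: real assume e: "e > 0"
  \<comment> \<open>Of \<open>e\<close>, one \<epsilon> pays for the intervals tagged in
    \<open>N\<close> and \<epsilon> * (b - a) for the others.\<close>
  define \<epsilon> where "\<epsilon> = e / (1 + (b - a))"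
  have \<epsilon>: "\<epsilon> > 0" and "\<epsilon> * (1 + (b - a)) = e"
    using e ab by (auto simp: \<epsilon>_def)
  then have eq: "\<epsilon> + \<epsilon> * (b - a) = e"
    by (simp add: distrib_left)
  have "\<exists>d>0. \<forall>\<D> C. \<D> division_of C \<and> C \<subseteq> {a..b} \<and> (\<Sum>K\<in>\<D>. Sup K - Inf K) < d
        \<longrightarrow> (\<Sum>K\<in>\<D>. \<bar>f (Sup K) - f (Inf K)\<bar>) < \<epsilon>"
    by (rule ac[unfolded abs_continuous_on_def, THEN spec, THEN mp]) fact
  then obtain d where d0: "d > 0" and d: "\<forall>\<D> C. \<D> division_of C \<and> C \<subseteq> {a..b} \<and> (\<Sum>K\<in>\<D>. Sup K - Inf K) < d
        \<longrightarrow> (\<Sum>K\<in>\<D>. \<bar>f (Sup K) - f (Inf K)\<bar>) < \<epsilon>"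
    by (elim exE conjE)
  obtain U where U: "open U" "N \<subseteq> U" "U \<in> lmeasurable" "measure lebesgue U < d"
  proof -
    obtain T where T: "open T" "N \<subseteq> T" "T - N \<in> lmeasurable" "emeasure lebesgue (T - N) < ennreal d"
      using sets_lebesgue_outer_open[OF negligible_imp_sets[OF N] d0] by blast
    have "T \<in> sets lebesgue" using T(1) by auto
    moreover have "emeasure lebesgue T = emeasure lebesgue (T - N)"
      using N T by (intro emeasure_Diff_null_set[symmetric]) (auto simp: negligible_iff_null_sets)
    ultimately show thesis using that[of T] T d0
      by (auto simp: fmeasurable_def measure_def enn2real_less_iff)
  qed
  \<comment> \<open>Off \<open>N\<close> the gauge enforces the straddle estimate given by the
    derivative at \<open>t\<close>; on \<open>N\<close> it forces the interval into
    \<open>U\<close>.\<close>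
  have "\<exists>g. open g \<and> t \<in> g \<and> (t \<in> N \<longrightarrow> g \<subseteq> U) \<and>
      (t \<in> {a..b} - N \<longrightarrow> (\<forall>u v. u \<le> t \<and> t \<le> v \<and> {u..v} \<subseteq> g \<longrightarrow> f v - f u \<le> \<epsilon> * (v - u)))" for t
  proof (cases "t \<in> {a..b} - N")
    case True
    then obtain D where D: "D \<le> 0" "(f has_real_derivative D) (at t)" using deriv by blast
    then have "(f has_derivative (*) D) (at t)" by (simp add: has_field_derivative_def)
    then obtain r where r: "r > 0" "\<And>s. norm (s - t) < r \<Longrightarrow> norm (f s - f t - D * (s - t)) \<le> \<epsilon> * norm (s - t)"
      using \<epsilon> unfolding has_derivative_at_alt by blast
    \<comment> \<open>Splitting at the tag \<open>t\<close> bounds each one-sided increment by its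
      linear part plus \<epsilon> times its length; the linear parts add up to D * (v - u) \<le>
      0.\<close>
    have "f v - f u \<le> \<epsilon> * (v - u)" if "u \<le> t" "t \<le> v" "{u..v} \<subseteq> ball t r" for u v
    proof -
      have "u \<in> {u..v}" "v \<in> {u..v}" using that by auto
      then have "u \<in> ball t r" "v \<in> ball t r" using that(3) by blast+
      then have uv: "norm (u - t) < r" "norm (v - t) < r" by (auto simp: dist_real_def abs_minus_commute)
      have "f v - f t - D * (v - t) \<le> \<epsilon> * (v - t)"
        using r(2)[OF uv(2)] that by (simp add: abs_le_iff)
      moreover have "- (f u - f t - D * (u - t)) \<le> \<epsilon> * (t - u)"
        using r(2)[OF uv(1)] that by (simp add: abs_le_iff algebra_simps)
      moreover have "D * (v - u) \<le> 0" using D that by (simp add: mult_nonpos_nonneg)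
      ultimately show ?thesis by (simp add: algebra_simps)
    qed
    then show ?thesis using r(1) True by (intro exI[of _ "ball t r"]) auto
  next
    case False
    then show ?thesis
      using U by (cases "t \<in> N") auto
  qed
  then obtain g where g: "\<And>t. open (g t) \<and> t \<in> g t \<and> (t \<in> N \<longrightarrow> g t \<subseteq> U) \<and>
      (t \<in> {a..b} - N \<longrightarrow> (\<forall>u v. u \<le> t \<and> t \<le> v \<and> {u..v} \<subseteq> g t \<longrightarrow> f v - f u \<le> \<epsilon> * (v - u)))"
    by metis
  have "gauge g" using g by (auto simp: gauge_def)
  then obtain p where p: "p tagged_division_of {a..b}" "g fine p"
    by (rule fine_division_exists_real)
  note pD = tagged_division_ofD[OF p(1)]
  have pK: "\<exists>u v. K = {u..v} \<and> u \<le> t \<and> t \<le> v \<and> Inf K = u \<and> Sup K = v \<and> K \<subseteq> g t" if tK: "(t, K) \<in> p" for t K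
  proof -
    obtain u v where K: "K = cbox u v" using pD(4)[OF tK] by blast
    have "t \<in> K" by (rule pD(2)[OF tK])
    moreover have "K \<subseteq> g t" using p(2) tK by (auto simp: fine_def)
    ultimately show ?thesis using K by (intro exI[of _ u] exI[of _ v]) auto
  qed
  define q where "q = {(t, K) \<in> p. t \<in> N}"
  have q: "q \<subseteq> p" "finite q" using pD(1) by (auto simp: q_def intro: finite_subset)
  have qp: "q tagged_partial_division_of {a..b}"
    using p(1) q(1) tagged_partial_division_subset unfolding tagged_division_of_def by blast
  then have dq: "snd ` q division_of \<Union>(snd ` q)"
    by (rule partial_division_of_tagged_division)
  have ne: "snd x \<noteq> {}" if "x \<in> q" for x
    using that q(1) pD(2) by (cases x) auto
  \<comment> \<open>Different tags can carry the same interval only if it is degenerate, so passing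
    from pairs to intervals is safe for an \<open>h\<close> that vanishes on singletons and on the
    empty set.\<close>
  have sumq: "(\<Sum>(t, K)\<in>q. h K) = (\<Sum>K\<in>snd ` q. h K)" if "\<And>u. h {u} = 0" "h {} = 0" for h :: "real set \<Rightarrow> real"
    by (rule sum.over_tagged_division_lemma[OF tagged_partial_division_of_Union_self[OF qp]])
      (use that in \<open>auto simp: box_eq_empty le_less\<close>)
  have "(\<Sum>K\<in>snd ` q. Sup K - Inf K) < d"
  proof -
    have "(\<Sum>K\<in>snd ` q. Sup K - Inf K) = (\<Sum>K\<in>snd ` q. measure lebesgue K)"
      by (rule sum.cong[OF refl], rule division_of_real_memberE[OF dq], assumption) auto
    also have "\<dots> = measure lebesgue (\<Union>(snd ` q))" by (rule content_division[OF dq])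
    also have "\<dots> \<le> measure lebesgue U"
    proof (rule measure_mono_fmeasurable)
      show "\<Union>(snd ` q) \<subseteq> U" using pK q(1) g unfolding q_def by fastforce
      show "\<Union>(snd ` q) \<in> sets lebesgue" using lmeasurable_division[OF dq] by blast
    qed (rule U(3))
    finally show ?thesis using U(4) by linarith
  qed
  moreover have "\<Union>(snd ` q) \<subseteq> {a..b}" using q(1) pD(3) by fastforce
  ultimately have "(\<Sum>K\<in>snd ` q. \<bar>f (Sup K) - f (Inf K)\<bar>) < \<epsilon>" using d dq by blast
  then have "(\<Sum>(t, K)\<in>q. \<bar>f (Sup K) - f (Inf K)\<bar>) < \<epsilon>"
  proof -
    \<comment> \<open>\<open>Sup\<close> and \<open>Inf\<close> of the empty set are unspecified, so
      \<open>sumq\<close> is applied to a function forced to vanish there.\<close>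
    have "(\<Sum>(t, K)\<in>q. \<bar>f (Sup K) - f (Inf K)\<bar>) = (\<Sum>(t, K)\<in>q. if K = {} then 0 else \<bar>f (Sup K) - f (Inf K)\<bar>)"
      by (rule sum.cong[OF refl]) (use ne in force)
    also have "\<dots> = (\<Sum>K\<in>snd ` q. if K = {} then 0 else \<bar>f (Sup K) - f (Inf K)\<bar>)"
      by (rule sumq) auto
    also have "\<dots> = (\<Sum>K\<in>snd ` q. \<bar>f (Sup K) - f (Inf K)\<bar>)"
      by (rule sum.cong[OF refl]) (use ne in force)
    finally show ?thesis using \<open>(\<Sum>K\<in>snd ` q. \<bar>f (Sup K) - f (Inf K)\<bar>) < \<epsilon>\<close> by simp
  qed
  moreover have "(\<Sum>(t, K)\<in>q. f (Sup K) - f (Inf K)) \<le> (\<Sum>(t, K)\<in>q. \<bar>f (Sup K) - f (Inf K)\<bar>)"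
    by (rule sum_mono) auto
  ultimately have A: "(\<Sum>(t, K)\<in>q. f (Sup K) - f (Inf K)) \<le> \<epsilon>" by linarith
  have "(\<Sum>(t, K)\<in>p - q. f (Sup K) - f (Inf K)) \<le> (\<Sum>(t, K)\<in>p - q. \<epsilon> * (Sup K - Inf K))"
  proof (rule sum_mono, clarify)
    fix t K assume tK: "(t, K) \<in> p" "(t, K) \<notin> q"
    then have "t \<in> {a..b} - N" using pD(2)[OF tK(1)] pD(3)[OF tK(1)] by (auto simp: q_def)
    then show "f (Sup K) - f (Inf K) \<le> \<epsilon> * (Sup K - Inf K)" using pK[OF tK(1)] g by metis
  qed
  also have "\<dots> \<le> (\<Sum>(t, K)\<in>p. \<epsilon> * (Sup K - Inf K))"
    using pD(1) \<epsilon> pK by (intro sum_mono2) fastforce+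
  also have "\<dots> = \<epsilon> * (\<Sum>(t, K)\<in>p. Sup K - Inf K)" by (simp add: sum_distrib_left case_prod_unfold)
  also have "\<dots> = \<epsilon> * (b - a)" using additive_tagged_division_1[OF ab p(1), of "\<lambda>x. x"] by simp
  finally have B: "(\<Sum>(t, K)\<in>p - q. f (Sup K) - f (Inf K)) \<le> \<epsilon> * (b - a)" .
  have "f b - f a = (\<Sum>(t, K)\<in>p. f (Sup K) - f (Inf K))"
    using additive_tagged_division_1[OF ab p(1), of f] by simp
  also have "\<dots> = (\<Sum>(t, K)\<in>p - q. f (Sup K) - f (Inf K)) + (\<Sum>(t, K)\<in>q. f (Sup K) - f (Inf K))"
    by (rule sum.subset_diff[OF q(1) pD(1)])
  finally show "f b \<le> f a + e" using A B eq by linarith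
qed

section \<open>Absolute values along a curve, and exceptional times\<close>

lemma countable_if_isolated:
  fixes S :: "'a::second_countable_topology set"
  assumes iso: "\<And>t. t \<in> S \<Longrightarrow> \<exists>U. open U \<and> U \<inter> S = {t}"
  shows "countable S"
proof -
  obtain B :: "'a set set" where B: "countable B" "topological_basis B"
    using ex_countable_basis by blast
  \<comment> \<open>Second countability: some basic \<open>V\<close> meets \<open>S\<close> in the
    given isolated point alone, and each \<open>W V\<close> has at most one element.\<close>
  define W where "W V = (if \<exists>t. V \<inter> S = {t} then V \<inter> S else {})" for V
  have "S \<subseteq> (\<Union>V\<in>B. W V)"
  proof
    fix t assume t: "t \<in> S"
    then obtain U where U: "open U" "U \<inter> S = {t}" using iso by blast
    then have "t \<in> U" by blast
    then obtain V where V: "V \<in> B" "t \<in> V" "V \<subseteq> U"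
      using topological_basisE[OF B(2) U(1)] by blast
    then have "V \<inter> S = {t}" using U(2) t by blast
    then have "t \<in> W V" unfolding W_def by auto
    then show "t \<in> (\<Union>V\<in>B. W V)" using V(1) by blast
  qed
  moreover have "countable (W V)" for V
    by (cases "\<exists>t. V \<inter> S = {t}") (auto simp: W_def)
  then have "countable (\<Union>V\<in>B. W V)"
    using B(1) by (intro countable_UN) auto
  ultimately show ?thesis by (rule countable_subset)
qed

text \<open>A nonzero derivative keeps \<open>f\<close> away from 0 nearby, so such zeros are
  isolated. For the coordinates of the flow these are the times at which the chain rule for the
  absolute value fails.\<close>

lemma countable_simple_zeros:
  fixes f :: "real \<Rightarrow> real"
  shows "countable {t. f t = 0 \<and> (\<exists>D. D \<noteq> 0 \<and> (f has_real_derivative D) (at t))}" (is "countable ?S")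
proof (rule countable_if_isolated)
  fix t assume tS: "t \<in> ?S"
  then obtain D where D: "f t = 0" "D \<noteq> 0" "(f has_real_derivative D) (at t)" by blast
  then have "((\<lambda>s. (f s - f t) / (s - t)) \<longlongrightarrow> D) (at t)" by (simp add: has_field_derivative_iff)
  then have "\<forall>\<^sub>F s in at t. (f s - f t) / (s - t) \<noteq> 0"
    using D(2) by (rule tendsto_imp_eventually_ne)
  then have "\<forall>\<^sub>F s in at t. f s \<noteq> 0"
    by (rule eventually_mono) (use D in simp)
  then obtain U where U: "open U" "t \<in> U" "\<forall>s\<in>U. s \<noteq> t \<longrightarrow> f s \<noteq> 0"
    unfolding eventually_at_topological by blast
  then have "U \<inter> ?S = {t}" using tS by blast
  then show "\<exists>U. open U \<and> U \<inter> ?S = {t}" using U(1) by blast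
qed

text \<open>At a zero the assumption D = 0 makes |f| flat as well, so every multiplier in [-1, 1] is
  correct. Thus the subgradient \<open>p\<close> of the inclusion can serve in the chain
  rule.\<close>

lemma has_real_derivative_abs_sgn_set:
  fixes f :: "real \<Rightarrow> real"
  assumes f: "(f has_real_derivative D) (at t)" and D0: "f t = 0 \<Longrightarrow> D = 0" and p: "p \<in> sgn_set (f t)"
  shows "((\<lambda>s. \<bar>f s\<bar>) has_real_derivative p * D) (at t)"
proof -
  have ct: "(f \<longlongrightarrow> f t) (at t)"
    using DERIV_isCont[OF f] by (simp add: isCont_def)
  consider "f t > 0" | "f t < 0" | "f t = 0" by linarith
  then show ?thesis
  proof cases
    case 1
    then have "\<forall>\<^sub>F s in nhds t. f s > 0"
      using order_tendstoD(1)[OF ct] eventually_nhds_conv_at by blast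
    then have "((\<lambda>s. \<bar>f s\<bar>) has_real_derivative D) (at t) \<longleftrightarrow> (f has_real_derivative D) (at t)"
      by (intro DERIV_cong_ev) (auto elim: eventually_mono)
    then show ?thesis using f p 1 by (simp add: sgn_set_def)
  next
    case 2
    then have "\<forall>\<^sub>F s in nhds t. f s < 0"
      using order_tendstoD(2)[OF ct] eventually_nhds_conv_at by blast
    then have "((\<lambda>s. \<bar>f s\<bar>) has_real_derivative - D) (at t) \<longleftrightarrow> ((\<lambda>s. - f s) has_real_derivative - D) (at t)"
      by (intro DERIV_cong_ev) (auto elim: eventually_mono)
    then show ?thesis using DERIV_minus[OF f] p 2 by (simp add: sgn_set_def)
  next
    case 3
    have "((\<lambda>s. (f s - f t) / (s - t)) \<longlongrightarrow> 0) (at t)"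
      using f D0[OF 3] by (simp add: has_field_derivative_iff)
    from tendsto_rabs_zero[OF this] have "((\<lambda>s. \<bar>(\<bar>f s\<bar> - \<bar>f t\<bar>) / (s - t)\<bar>) \<longlongrightarrow> 0) (at t)"
      using 3 by simp
    then have "((\<lambda>s. (\<bar>f s\<bar> - \<bar>f t\<bar>) / (s - t)) \<longlongrightarrow> 0) (at t)"
      by (rule tendsto_rabs_zero_cancel)
    then show ?thesis using D0[OF 3] by (simp add: has_field_derivative_iff)
  qed
qed

text \<open>A strict violation at \<open>t\<close> would persist on a nonempty open set, which
  cannot be negligible. This carries the final bound from almost every time to every time.\<close>

lemma le_if_le_outside_negligible:
  fixes N :: "real set"
  assumes "negligible N" and "a < t" and f: "isCont f t" and le: "\<And>s. a < s \<Longrightarrow> s \<notin> N \<Longrightarrow> f s \<le> (c::real)"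
  shows "f t \<le> c"
proof (rule ccontr)
  assume "\<not> f t \<le> c"
  then have "\<forall>\<^sub>F s in nhds t. f s > c"
    using f order_tendstoD(1)[of f "f t" "at t" c] unfolding isCont_def
    by (auto simp: eventually_nhds_conv_at)
  moreover have "\<forall>\<^sub>F s in nhds t. s > a"
    using eventually_nhds_in_open[of "{a<..}" t] \<open>a < t\<close> by simp
  ultimately have "\<forall>\<^sub>F s in nhds t. s \<in> N"
  proof eventually_elim
    case (elim s)
    then show ?case using le[of s] by fastforce
  qed
  then obtain U where U: "open U" "t \<in> U" "U \<subseteq> N" unfolding eventually_nhds by blast
  then have "negligible U" using assms(1) negligible_subset by blast
  then show False using U open_not_negligible by blast
qed

lemmas abs_continuous_on_intros =
  abs_continuous_on_const abs_continuous_on_ident abs_continuous_on_add abs_continuous_on_diff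
  abs_continuous_on_mult abs_continuous_on_abs abs_continuous_on_power2 abs_continuous_on_sum

subsection \<open>The flow\<close>

lemma sgn_set_mult_eq_abs: "p \<in> sgn_set s \<Longrightarrow> p * s = \<bar>s\<bar>"
  by (auto simp: sgn_set_def split: if_splits)

lemma sgn_set_abs_le_1: "p \<in> sgn_set s \<Longrightarrow> \<bar>p\<bar> \<le> 1"
  by (auto simp: sgn_set_def split: if_splits)

lemma sgn_set_subgradient: "p \<in> sgn_set s \<Longrightarrow> \<bar>s\<bar> + p * (t - s) \<le> \<bar>t\<bar>"
proof -
  assume p: "p \<in> sgn_set s"
  have "p * t \<le> \<bar>p\<bar> * \<bar>t\<bar>" by (metis abs_ge_self abs_mult)
  also have "\<dots> \<le> \<bar>t\<bar>" using mult_right_mono[OF sgn_set_abs_le_1[OF p], of "\<bar>t\<bar>"] by simp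
  finally show ?thesis using sgn_set_mult_eq_abs[OF p] by (simp add: algebra_simps)
qed

lemma sgn_set_mono:
  assumes "p \<in> sgn_set s" "q \<in> sgn_set t"
  shows "0 \<le> (s - t) * (p - q)"
  using sgn_set_subgradient[OF assms(1), of t] sgn_set_subgradient[OF assms(2), of s]
  by (simp add: algebra_simps)

text \<open>Vectors are functions of the index here, read only below \<open>n\<close>: finite sums
  and the product topology apply to them while the dimensions remain values.\<close>

definition mat_app :: "nat \<Rightarrow> (nat \<Rightarrow> nat \<Rightarrow> real) \<Rightarrow> (nat \<Rightarrow> real) \<Rightarrow> nat \<Rightarrow> real" where
  "mat_app n a v j = (\<Sum>i<n. a j i * v i)"

lemma mat_app_diff: "mat_app n a (\<lambda>i. u i - v i) j = mat_app n a u j - mat_app n a v j"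
  by (simp add: mat_app_def right_diff_distrib sum_subtractf)

lemma sum_mat_app_adjoint:
  "(\<Sum>i<n. u i * (\<Sum>j<m. a j i * w j)) = (\<Sum>j<m. w j * mat_app n a u j)"
proof -
  have "(\<Sum>i<n. u i * (\<Sum>j<m. a j i * w j)) = (\<Sum>i<n. \<Sum>j<m. w j * (a j i * u i))"
    by (simp add: sum_distrib_left ac_simps)
  also have "\<dots> = (\<Sum>j<m. w j * mat_app n a u j)"
    by (subst sum.swap) (simp add: mat_app_def sum_distrib_left)
  finally show ?thesis .
qed

text \<open>\<open>x'\<close> and \<open>p\<close> are pointwise choices of velocity and subgradient
  off one null set for all times. Only signs of derivatives at single points are used later, so
  these choices need not be related to each other.\<close>

locale l1_flow =
  fixes n m :: nat and a :: "nat \<Rightarrow> nat \<Rightarrow> real" and y :: "nat \<Rightarrow> real" and \<tau> :: real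
    and x z x' p :: "real \<Rightarrow> nat \<Rightarrow> real" and N :: "real set"
  assumes tau: "\<tau> > 0" and N: "negligible N"
    and ac_x: "\<And>i b. i < n \<Longrightarrow> 0 < b \<Longrightarrow> abs_continuous_on {0..b} (\<lambda>t. x t i)"
    and ac_z: "\<And>j b. j < m \<Longrightarrow> 0 < b \<Longrightarrow> abs_continuous_on {0..b} (\<lambda>t. z t j)"
    and z0: "\<And>j. j < m \<Longrightarrow> z 0 j = 0"
    and dx: "\<And>t i. 0 < t \<Longrightarrow> t \<notin> N \<Longrightarrow> i < n \<Longrightarrow> ((\<lambda>s. x s i) has_real_derivative x' t i) (at t)"
    and dz: "\<And>t j. 0 < t \<Longrightarrow> t \<notin> N \<Longrightarrow> j < m \<Longrightarrow>
      ((\<lambda>s. z s j) has_real_derivative y j - mat_app n a (x t) j) (at t)"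
    and x'_eq: "\<And>t i. 0 < t \<Longrightarrow> t \<notin> N \<Longrightarrow> i < n \<Longrightarrow>
      x' t i = (\<Sum>j<m. a j i * (z t j - mat_app n a (x t) j + y j)) - \<tau> * p t i"
    and p_sgn: "\<And>t i. 0 < t \<Longrightarrow> t \<notin> N \<Longrightarrow> i < n \<Longrightarrow> p t i \<in> sgn_set (x t i)"
begin

definition r :: "real \<Rightarrow> nat \<Rightarrow> real" where
  "r t j = mat_app n a (x t) j - y j"

lemma dz_r: "0 < t \<Longrightarrow> t \<notin> N \<Longrightarrow> j < m \<Longrightarrow> ((\<lambda>s. z s j) has_real_derivative - r t j) (at t)"
  using dz by (simp add: r_def)

lemma dr: "0 < t \<Longrightarrow> t \<notin> N \<Longrightarrow> ((\<lambda>s. r s j) has_real_derivative mat_app n a (x' t) j) (at t)"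
  unfolding r_def mat_app_def
  by (auto intro!: derivative_eq_intros dx simp: mult.commute)

text \<open>Weak form of the inclusion. It is tested with the increment under a time shift
  (contraction), with the displacement x - xb (dissipation) and with the velocity itself
  (energy).\<close>

lemma pairing:
  assumes "0 < t" "t \<notin> N"
  shows "(\<Sum>i<n. u i * x' t i) = (\<Sum>j<m. (z t j - r t j) * mat_app n a u j) - \<tau> * (\<Sum>i<n. u i * p t i)"
proof -
  have "(\<Sum>i<n. u i * x' t i) = (\<Sum>i<n. u i * (\<Sum>j<m. a j i * (z t j - r t j)) - \<tau> * (u i * p t i))"
    using assms by (intro sum.cong) (auto simp: x'_eq r_def algebra_simps)
  then show ?thesis by (simp add: sum_subtractf sum_distrib_left[symmetric] sum_mat_app_adjoint)
qed

lemma ac_x': "i < n \<Longrightarrow> 0 \<le> s \<Longrightarrow> abs_continuous_on {s..b} (\<lambda>t. x t i)"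
  by (rule abs_continuous_on_subset[OF ac_x[of i "\<bar>b\<bar> + 1"]]) auto

lemma ac_z': "j < m \<Longrightarrow> 0 \<le> s \<Longrightarrow> abs_continuous_on {s..b} (\<lambda>t. z t j)"
  by (rule abs_continuous_on_subset[OF ac_z[of j "\<bar>b\<bar> + 1"]]) auto

lemma ac_r: "0 \<le> s \<Longrightarrow> abs_continuous_on {s..b} (\<lambda>t. r t j)"
  unfolding r_def mat_app_def by (intro abs_continuous_on_intros ac_x') auto

text \<open>Squared norm of the velocity of (x, z), since \<open>r\<close> is minus the velocity of
  \<open>z\<close>.\<close>

definition speed2 :: "real \<Rightarrow> real" where
  "speed2 t = (\<Sum>i<n. (x' t i)\<^sup>2) + (\<Sum>j<m. (r t j)\<^sup>2)"

lemma speed2_nonneg: "0 \<le> speed2 t"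
  by (simp add: speed2_def add_nonneg_nonneg sum_nonneg)

text \<open>In the derivative, the terms coupling \<open>x\<close> and \<open>z\<close> through the
  matrix and its transpose cancel. There remain minus twice the squared increment of
  \<open>r\<close> and a term whose sign comes from monotonicity of \<open>sgn_set\<close>.\<close>

lemma shift_contraction:
  assumes h: "0 < h" and st: "0 \<le> s" "s \<le> t"
  shows "(\<Sum>i<n. (x (t + h) i - x t i)\<^sup>2) + (\<Sum>j<m. (z (t + h) j - z t j)\<^sup>2)
    \<le> (\<Sum>i<n. (x (s + h) i - x s i)\<^sup>2) + (\<Sum>j<m. (z (s + h) j - z s j)\<^sup>2)"
proof (rule abs_continuous_on_nonincreasing[where f = "\<lambda>t. (\<Sum>i<n. (x (t + h) i - x t i)\<^sup>2) + (\<Sum>j<m. (z (t + h) j - z t j)\<^sup>2)"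
    and N = "N \<union> {0} \<union> (\<lambda>t. t - h) ` N"])
  \<comment> \<open>Both \<open>t\<close> and \<open>t + h\<close> have to avoid \<open>N\<close>,
    hence the translate; the equations are assumed at positive times, hence 0.\<close>
  show "negligible (N \<union> {0} \<union> (\<lambda>t. t - h) ` N)"
    using N negligible_translation[OF N, of "-h"] by simp
  show "abs_continuous_on {s..t} (\<lambda>t. (\<Sum>i<n. (x (t + h) i - x t i)\<^sup>2) + (\<Sum>j<m. (z (t + h) j - z t j)\<^sup>2))"
    using h st by (intro abs_continuous_on_intros abs_continuous_on_shift ac_x' ac_z') auto
  fix u assume u: "u \<in> {s..t} - (N \<union> {0} \<union> (\<lambda>t. t - h) ` N)"
  have u0: "0 < u" "u \<notin> N" using u st by auto
  have uh: "0 < u + h" "u + h \<notin> N" using u st h by (force simp: image_iff)+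
  define D where "D = (\<Sum>i<n. 2 * (x (u + h) i - x u i) * (x' (u + h) i - x' u i))
      + (\<Sum>j<m. 2 * (z (u + h) j - z u j) * (r u j - r (u + h) j))"
  have dxh: "((\<lambda>s. x (s + h) i) has_real_derivative x' (u + h) i) (at u)" if "i < n" for i
    by (rule DERIV_shift[THEN iffD1, OF dx[OF uh that]])
  have dzh: "((\<lambda>s. z (s + h) j) has_real_derivative - r (u + h) j) (at u)" if "j < m" for j
    by (rule DERIV_shift[THEN iffD1, OF dz_r[OF uh that]])
  have "((\<lambda>t. (\<Sum>i<n. (x (t + h) i - x t i)\<^sup>2) + (\<Sum>j<m. (z (t + h) j - z t j)\<^sup>2)) has_real_derivative D) (at u)"
    unfolding D_def
    by (auto intro!: derivative_eq_intros dx[OF u0] dz_r[OF u0] dxh dzh sum.cong simp: algebra_simps)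
  moreover have "D \<le> 0"
  proof -
    define e where "e i = x (u + h) i - x u i" for i
    have me: "mat_app n a e j = r (u + h) j - r u j" for j
      by (simp add: e_def[abs_def] mat_app_diff r_def)
    have "(\<Sum>i<n. 2 * e i * (x' (u + h) i - x' u i)) = 2 * ((\<Sum>i<n. e i * x' (u + h) i) - (\<Sum>i<n. e i * x' u i))"
      by (simp add: sum_distrib_left sum_subtractf algebra_simps)
    also have "\<dots> = 2 * ((\<Sum>j<m. (z (u + h) j - r (u + h) j) * mat_app n a e j) - (\<Sum>j<m. (z u j - r u j) * mat_app n a e j))
        - 2 * \<tau> * ((\<Sum>i<n. e i * p (u + h) i) - (\<Sum>i<n. e i * p u i))"
      unfolding pairing[OF uh] pairing[OF u0] by (simp add: algebra_simps)
    also have "\<dots> = (\<Sum>j<m. 2 * ((z (u + h) j - z u j) - (r (u + h) j - r u j)) * (r (u + h) j - r u j))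
        - 2 * \<tau> * (\<Sum>i<n. e i * (p (u + h) i - p u i))"
      by (simp add: me sum_distrib_left sum_subtractf[symmetric] algebra_simps)
    finally have "D = (\<Sum>j<m. 2 * ((z (u + h) j - z u j) - (r (u + h) j - r u j)) * (r (u + h) j - r u j))
        + (\<Sum>j<m. 2 * (z (u + h) j - z u j) * (r u j - r (u + h) j)) - 2 * \<tau> * (\<Sum>i<n. e i * (p (u + h) i - p u i))"
      unfolding D_def e_def by simp
    also have "\<dots> = - 2 * (\<Sum>j<m. (r (u + h) j - r u j)\<^sup>2) - 2 * \<tau> * (\<Sum>i<n. e i * (p (u + h) i - p u i))"
      by (simp add: sum.distrib[symmetric] sum_distrib_left algebra_simps power2_eq_square)
    also have "\<dots> \<le> 0"
    proof -
      have "0 \<le> (\<Sum>i<n. e i * (p (u + h) i - p u i))"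
        unfolding e_def by (intro sum_nonneg sgn_set_mono p_sgn uh u0) auto
      then have "0 \<le> 2 * \<tau> * (\<Sum>i<n. e i * (p (u + h) i - p u i))" using tau by simp
      moreover have "0 \<le> (\<Sum>j<m. (r (u + h) j - r u j)\<^sup>2)" by (intro sum_nonneg) auto
      ultimately show ?thesis by linarith
    qed
    finally show ?thesis .
  qed
  ultimately show "\<exists>D\<le>0. ((\<lambda>t. (\<Sum>i<n. (x (t + h) i - x t i)\<^sup>2) + (\<Sum>j<m. (z (t + h) j - z t j)\<^sup>2)) has_real_derivative D) (at u)"
    by blast
qed (use st in auto)

lemma tendsto_shift_quotient:
  assumes "0 < t" "t \<notin> N"
  shows "((\<lambda>h. ((\<Sum>i<n. (x (t + h) i - x t i)\<^sup>2) + (\<Sum>j<m. (z (t + h) j - z t j)\<^sup>2)) / h\<^sup>2) \<longlongrightarrow> speed2 t) (at_right 0)"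
proof -
  have X: "((\<lambda>h. (x (t + h) i - x t i) / h) \<longlongrightarrow> x' t i) (at_right 0)" if "i < n" for i
    using dx[OF assms that] unfolding DERIV_def by (simp add: filterlim_at_split)
  have Z: "((\<lambda>h. (z (t + h) j - z t j) / h) \<longlongrightarrow> - r t j) (at_right 0)" if "j < m" for j
    using dz_r[OF assms that] unfolding DERIV_def by (simp add: filterlim_at_split)
  have "((\<lambda>h. (\<Sum>i<n. ((x (t + h) i - x t i) / h)\<^sup>2) + (\<Sum>j<m. ((z (t + h) j - z t j) / h)\<^sup>2))
      \<longlongrightarrow> (\<Sum>i<n. (x' t i)\<^sup>2) + (\<Sum>j<m. (- r t j)\<^sup>2)) (at_right 0)"
    by (intro tendsto_intros X Z) auto
  then show ?thesis
    by (simp add: speed2_def power_divide add_divide_distrib sum_divide_distrib)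
qed

text \<open>Divide the contraction of the shift by h^2 and let h tend to 0: speeds are compared
  without differentiating the velocity.\<close>

lemma speed2_mono:
  assumes "0 < s" "s \<notin> N" "s \<le> t" "t \<notin> N"
  shows "speed2 t \<le> speed2 s"
proof (rule tendsto_le)
  show "\<forall>\<^sub>F h in at_right 0. ((\<Sum>i<n. (x (t + h) i - x t i)\<^sup>2) + (\<Sum>j<m. (z (t + h) j - z t j)\<^sup>2)) / h\<^sup>2
     \<le> ((\<Sum>i<n. (x (s + h) i - x s i)\<^sup>2) + (\<Sum>j<m. (z (s + h) j - z s j)\<^sup>2)) / h\<^sup>2"
    using eventually_at_right_less[of 0]
    by (rule eventually_mono) (use assms in \<open>auto intro!: divide_right_mono shift_contraction\<close>)
qed (use assms in \<open>auto intro!: tendsto_shift_quotient\<close>)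

end

subsection \<open>Decay towards an equilibrium\<close>

locale l1_flow_with_equilibrium = l1_flow +
  fixes xb q :: "nat \<Rightarrow> real"
  assumes feasible: "\<And>j. j < m \<Longrightarrow> mat_app n a xb j = y j"
    and certificate: "\<And>i. i < n \<Longrightarrow> (\<Sum>j<m. a j i * q j) \<in> sgn_set (xb i)"
begin

text \<open>At xb with dual variable \<tau> q the residual is 0 and the velocity is A^T (\<tau> q) -
  \<tau> pb = 0.\<close>

abbreviation pb :: "nat \<Rightarrow> real" where
  "pb i \<equiv> \<Sum>j<m. a j i * q j"

definition dist2 :: "real \<Rightarrow> real" where
  "dist2 t = (\<Sum>i<n. (x t i - xb i)\<^sup>2) + (\<Sum>j<m. (z t j - \<tau> * q j)\<^sup>2)"

text \<open>Half the rate at which \<open>dist2\<close> decreases. The second sum is the symmetric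
  Bregman distance of the l1 norm between x and xb.\<close>

definition dissipation :: "real \<Rightarrow> real" where
  "dissipation t = (\<Sum>j<m. (r t j)\<^sup>2) + \<tau> * (\<Sum>i<n. (x t i - xb i) * (p t i - pb i))"

text \<open>Up to \<open>dist2\<close> this is the energy \<open>\<tau> |x|\<^sub>1 + |Ax - y|\<^sup>2 / 2 - z \<bullet> (Ax - y)\<close>, whose derivative along
  the flow is \<open>|z'|\<^sup>2 - |x'|\<^sup>2\<close>; adding \<open>dist2\<close> makes the derivative at most \<open>- |x'|\<^sup>2 - |z'|\<^sup>2\<close>. No bound
  on the initial velocity enters, which is what keeps the estimate free of the dimension.\<close>

definition lyapunov :: "real \<Rightarrow> real" where
  "lyapunov t = \<tau> * (\<Sum>i<n. \<bar>x t i\<bar>) + (\<Sum>j<m. (r t j)\<^sup>2 / 2 - z t j * r t j) + dist2 t"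

text \<open>At a zero of \<open>x i\<close> with nonzero derivative \<open>\<bar>x i\<bar>\<close> is not differentiable.\<close>

definition exceptional :: "real set" where
  "exceptional = N \<union> {0} \<union> (\<Union>i<n. {t. x t i = 0 \<and> (\<exists>D. D \<noteq> 0 \<and> ((\<lambda>s. x s i) has_real_derivative D) (at t))})"

lemma negligible_exceptional: "negligible exceptional"
  unfolding exceptional_def
  by (intro negligible_Un N negligible_Union countable_UN ballI)
    (auto intro!: countable_imp_null_set_lborel[THEN null_sets_completionI] countable_simple_zeros simp: negligible_iff_null_sets)

lemma mat_app_error: "j < m \<Longrightarrow> mat_app n a (\<lambda>i. x t i - xb i) j = r t j"
  by (simp add: mat_app_diff feasible r_def)

lemma sum_error_pb: "(\<Sum>i<n. (x t i - xb i) * pb i) = (\<Sum>j<m. q j * r t j)"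
  by (simp add: sum_mat_app_adjoint mat_app_error)

lemma dissipation_ge:
  assumes "0 < t" "t \<notin> N"
  shows "(\<Sum>j<m. (r t j)\<^sup>2) \<le> dissipation t"
  unfolding dissipation_def
  using tau sum_nonneg[of "{..<n}" "\<lambda>i. (x t i - xb i) * (p t i - pb i)"]
    sgn_set_mono[OF p_sgn[OF assms] certificate] by simp

lemma dissipation_nonneg: "0 < t \<Longrightarrow> t \<notin> N \<Longrightarrow> 0 \<le> dissipation t"
  using dissipation_ge[of t] sum_nonneg[of "{..<m}" "\<lambda>j. (r t j)\<^sup>2"] by simp

text \<open>The left side is the inner product of velocity and displacement from the equilibrium. It
  is read in two ways: as half the derivative of \<open>dist2\<close>, and, by Cauchy-Schwarz, as a
  bound of the dissipation by speed times distance.\<close>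

lemma dissipation_eq:
  assumes "0 < t" "t \<notin> N"
  shows "(\<Sum>i<n. (x t i - xb i) * x' t i) - (\<Sum>j<m. (z t j - \<tau> * q j) * r t j) = - dissipation t"
proof -
  have "(\<Sum>i<n. (x t i - xb i) * x' t i)
      = (\<Sum>j<m. (z t j - r t j) * r t j) - \<tau> * (\<Sum>i<n. (x t i - xb i) * p t i)"
    unfolding pairing[OF assms] by (simp add: mat_app_error)
  also have "(\<Sum>i<n. (x t i - xb i) * p t i)
      = (\<Sum>i<n. (x t i - xb i) * (p t i - pb i)) + (\<Sum>j<m. q j * r t j)"
    unfolding sum_error_pb[symmetric] by (simp add: sum.distrib[symmetric] algebra_simps)
  finally show ?thesis
    by (simp add: dissipation_def sum_subtractf sum_distrib_left algebra_simps power2_eq_square)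
qed

lemma dist2_nonneg: "0 \<le> dist2 t"
  by (simp add: dist2_def add_nonneg_nonneg sum_nonneg)

lemma has_derivative_dist2:
  assumes "0 < t" "t \<notin> N"
  shows "(dist2 has_real_derivative - 2 * dissipation t) (at t)"
proof -
  have "(dist2 has_real_derivative
      (\<Sum>i<n. 2 * (x t i - xb i) * x' t i) + (\<Sum>j<m. 2 * (z t j - \<tau> * q j) * (- r t j))) (at t)"
    unfolding dist2_def
    by (auto intro!: derivative_eq_intros dx[OF assms] dz_r[OF assms] sum.cong simp: algebra_simps)
  also have "(\<Sum>i<n. 2 * (x t i - xb i) * x' t i) + (\<Sum>j<m. 2 * (z t j - \<tau> * q j) * (- r t j))
      = 2 * ((\<Sum>i<n. (x t i - xb i) * x' t i) - (\<Sum>j<m. (z t j - \<tau> * q j) * r t j))"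
    by (simp add: sum_distrib_left right_diff_distrib sum_negf mult.assoc[symmetric])
  finally show ?thesis unfolding dissipation_eq[OF assms] by simp
qed

lemma has_derivative_lyapunov:
  assumes "0 < t" "t \<notin> exceptional"
  shows "(lyapunov has_real_derivative
    - (\<Sum>i<n. (x' t i)\<^sup>2) + (\<Sum>j<m. (r t j)\<^sup>2) - 2 * dissipation t) (at t)"
proof -
  have tN: "t \<notin> N" using assms(2) by (simp add: exceptional_def)
  have dabs: "((\<lambda>s. \<bar>x s i\<bar>) has_real_derivative p t i * x' t i) (at t)" if "i < n" for i
  proof (rule has_real_derivative_abs_sgn_set)
    show "((\<lambda>s. x s i) has_real_derivative x' t i) (at t)" using dx assms(1) tN that by blast
    then show "x t i = 0 \<Longrightarrow> x' t i = 0" using assms(2) that by (auto simp: exceptional_def)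
    show "p t i \<in> sgn_set (x t i)" using p_sgn assms(1) tN that by blast
  qed
  have "(lyapunov has_real_derivative
      \<tau> * (\<Sum>i<n. p t i * x' t i)
      + (\<Sum>j<m. r t j * mat_app n a (x' t) j - (z t j * mat_app n a (x' t) j - r t j * r t j))
      + - 2 * dissipation t) (at t)"
    unfolding lyapunov_def
    by (intro DERIV_add has_derivative_dist2 assms(1) tN)
      (auto intro!: derivative_eq_intros dabs dr[OF assms(1) tN] dz_r[OF assms(1) tN] sum.cong simp: algebra_simps)
  \<comment> \<open>Testing the equation with its own velocity turns the derivative of the energy
    into squares.\<close>
  moreover have "(\<Sum>i<n. (x' t i)\<^sup>2) = (\<Sum>j<m. (z t j - r t j) * mat_app n a (x' t) j) - \<tau> * (\<Sum>i<n. x' t i * p t i)"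
    using pairing[OF assms(1) tN, of "x' t"] by (simp add: power2_eq_square)
  then have "\<tau> * (\<Sum>i<n. p t i * x' t i)
      + (\<Sum>j<m. r t j * mat_app n a (x' t) j - (z t j * mat_app n a (x' t) j - r t j * r t j))
      + - 2 * dissipation t = - (\<Sum>i<n. (x' t i)\<^sup>2) + (\<Sum>j<m. (r t j)\<^sup>2) - 2 * dissipation t"
    by (simp add: sum_subtractf sum.distrib algebra_simps power2_eq_square)
  ultimately show ?thesis by simp
qed

text \<open>Write z = \<tau> q + (z - \<tau> q) in the indefinite product of z and r. The part with
  \<tau> q is absorbed by \<tau> times the l1 norm because of the certificate; the rest completes to
  squares with |r|^2 / 2 and \<open>dist2\<close>.\<close>

lemma lyapunov_nonneg: "0 \<le> lyapunov t"
proof -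
  have "\<tau> * (\<Sum>j<m. q j * r t j) \<le> \<tau> * (\<Sum>i<n. \<bar>x t i\<bar>)"
  proof (rule mult_left_mono)
    have "(x t i - xb i) * pb i \<le> \<bar>x t i\<bar>" if "i < n" for i
      using sgn_set_subgradient[OF certificate[OF that], of "x t i"] abs_ge_zero[of "xb i"]
      by (simp add: mult.commute)
    then show "(\<Sum>j<m. q j * r t j) \<le> (\<Sum>i<n. \<bar>x t i\<bar>)"
      unfolding sum_error_pb[symmetric] by (intro sum_mono) auto
  qed (use tau in simp)
  moreover have "0 \<le> (\<Sum>j<m. (r t j)\<^sup>2 / 2 - z t j * r t j + (z t j - \<tau> * q j)\<^sup>2) + \<tau> * (\<Sum>j<m. q j * r t j)"
  proof -
    have "0 \<le> (r t j)\<^sup>2 / 2 - (z t j - \<tau> * q j) * r t j + (z t j - \<tau> * q j)\<^sup>2" for j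
    proof -
      have eq: "(r t j)\<^sup>2 / 2 - (z t j - \<tau> * q j) * r t j + (z t j - \<tau> * q j)\<^sup>2
          = ((r t j - (z t j - \<tau> * q j))\<^sup>2 + (z t j - \<tau> * q j)\<^sup>2) / 2"
        by (simp add: power2_eq_square field_simps)
      show ?thesis unfolding eq by simp
    qed
    then have "0 \<le> (\<Sum>j<m. (r t j)\<^sup>2 / 2 - (z t j - \<tau> * q j) * r t j + (z t j - \<tau> * q j)\<^sup>2)"
      by (intro sum_nonneg) auto
    also have "\<dots> = (\<Sum>j<m. (r t j)\<^sup>2 / 2 - z t j * r t j + (z t j - \<tau> * q j)\<^sup>2) + \<tau> * (\<Sum>j<m. q j * r t j)"
      by (simp add: sum_distrib_left sum.distrib[symmetric] algebra_simps)
    finally show ?thesis .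
  qed
  moreover have "0 \<le> (\<Sum>i<n. (x t i - xb i)\<^sup>2)" by (intro sum_nonneg) auto
  ultimately show ?thesis unfolding lyapunov_def dist2_def by (simp add: sum.distrib)
qed

lemma ac_dist2: "abs_continuous_on {0..b} dist2"
  unfolding dist2_def by (intro abs_continuous_on_intros ac_x' ac_z') auto

lemma ac_lyapunov: "abs_continuous_on {0..b} lyapunov"
proof -
  have "abs_continuous_on {0..b} (\<lambda>t. \<tau> * (\<Sum>i<n. \<bar>x t i\<bar>)
      + (\<Sum>j<m. (1/2) * (r t j)\<^sup>2 - z t j * r t j) + dist2 t)"
    by (intro abs_continuous_on_intros ac_x' ac_z' ac_r ac_dist2) auto
  then show ?thesis unfolding lyapunov_def by simp
qed

lemma dist2_le: "0 \<le> t \<Longrightarrow> dist2 t \<le> dist2 0"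
proof (rule abs_continuous_on_nonincreasing[OF ac_dist2 _ negligible_exceptional])
  fix s assume "s \<in> {0..t} - exceptional"
  then have s: "0 < s" "s \<notin> N" by (auto simp: exceptional_def)
  show "\<exists>D\<le>0. (dist2 has_real_derivative D) (at s)"
    using has_derivative_dist2[OF s] dissipation_nonneg[OF s]
    by (intro exI[of _ "- 2 * dissipation s"]) simp
qed

text \<open>No integral is taken: by monotonicity the constant \<open>speed2 t\<close> is below the
  speed at every earlier regular time, so \<open>lyapunov s + speed2 t * s\<close> is nonincreasing
  in \<open>s\<close> up to \<open>t\<close>.\<close>

lemma speed2_decay:
  assumes t: "0 < t" "t \<notin> exceptional"
  shows "speed2 t * t \<le> lyapunov 0"
proof -
  have "lyapunov t + speed2 t * t \<le> lyapunov 0 + speed2 t * 0"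
  proof (rule abs_continuous_on_nonincreasing[where f = "\<lambda>s. lyapunov s + speed2 t * s", OF _ _ negligible_exceptional])
    show "abs_continuous_on {0..t} (\<lambda>s. lyapunov s + speed2 t * s)"
      by (intro abs_continuous_on_intros ac_lyapunov)
    fix s assume "s \<in> {0..t} - exceptional"
    then have s: "0 < s" "s \<notin> exceptional" "s \<notin> N" "s \<le> t" by (auto simp: exceptional_def)
    have "((\<lambda>s. lyapunov s + speed2 t * s) has_real_derivative
        (- (\<Sum>i<n. (x' s i)\<^sup>2) + (\<Sum>j<m. (r s j)\<^sup>2) - 2 * dissipation s) + speed2 t) (at s)"
      by (auto intro!: derivative_eq_intros has_derivative_lyapunov s)
    moreover have "(- (\<Sum>i<n. (x' s i)\<^sup>2) + (\<Sum>j<m. (r s j)\<^sup>2) - 2 * dissipation s) + speed2 t \<le> 0"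
      using dissipation_ge[OF s(1,3)] speed2_mono[OF s(1,3,4)] t(2)
      unfolding speed2_def[of s] by (simp add: exceptional_def)
    ultimately show "\<exists>D\<le>0. ((\<lambda>s. lyapunov s + speed2 t * s) has_real_derivative D) (at s)" by blast
  qed (use t in auto)
  then show ?thesis using lyapunov_nonneg[of t] by simp
qed

lemma dissipation_le_speed:
  assumes "0 < t" "t \<notin> N"
  shows "dissipation t \<le> sqrt (speed2 t) * sqrt (dist2 0)"
proof -
  have "dissipation t = (\<Sum>i<n. (xb i - x t i) * x' t i) + (\<Sum>j<m. (z t j - \<tau> * q j) * r t j)"
    using dissipation_eq[OF assms] by (simp add: sum_negf[symmetric] left_diff_distrib sum_subtractf)
  also have "\<dots> \<le> L2_set (\<lambda>i. xb i - x t i) {..<n} * L2_set (x' t) {..<n}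
      + L2_set (\<lambda>j. z t j - \<tau> * q j) {..<m} * L2_set (r t) {..<m}"
    by (intro add_mono order_trans[OF _ L2_set_mult_ineq] sum_mono) (simp_all add: abs_mult[symmetric])
  also have "\<dots> \<le> sqrt ((L2_set (\<lambda>i. xb i - x t i) {..<n})\<^sup>2 + (L2_set (\<lambda>j. z t j - \<tau> * q j) {..<m})\<^sup>2)
      * sqrt ((L2_set (x' t) {..<n})\<^sup>2 + (L2_set (r t) {..<m})\<^sup>2)"
  proof -
    have *: "A * B + C * D \<le> sqrt (A\<^sup>2 + C\<^sup>2) * sqrt (B\<^sup>2 + D\<^sup>2)" for A B C D :: real
    proof -
      \<comment> \<open>Lagrange's identity, which merges the two Cauchy-Schwarz products into one
        on the product space.\<close>
      have "(A * B + C * D)\<^sup>2 + (A * D - B * C)\<^sup>2 = (A\<^sup>2 + C\<^sup>2) * (B\<^sup>2 + D\<^sup>2)"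
        by (simp add: power2_eq_square algebra_simps)
      then have "(A * B + C * D)\<^sup>2 \<le> (A\<^sup>2 + C\<^sup>2) * (B\<^sup>2 + D\<^sup>2)"
        by (metis le_add_same_cancel1 zero_le_power2)
      then show ?thesis by (simp add: real_le_rsqrt flip: real_sqrt_mult)
    qed
    show ?thesis by (rule *)
  qed
  also have "\<dots> = sqrt (dist2 t) * sqrt (speed2 t)"
    by (simp add: L2_set_def sum_nonneg dist2_def speed2_def power2_commute)
  also have "\<dots> \<le> sqrt (dist2 0) * sqrt (speed2 t)"
    using dist2_le[of t] assms(1) speed2_nonneg[of t] by (intro mult_right_mono) auto
  finally show ?thesis by (simp add: mult.commute)
qed

text \<open>The gap is bounded by the speed times a constant: the Bregman distance contributes sqrt
  C / \<tau>, the pairing of \<open>q\<close> with the residual and the penalty term contribute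
  \<rho> each. Since speed times sqrt t is at most sqrt C, multiplying by sqrt t leaves a
  constant.\<close>

lemma penalty_gap_le:
  assumes t: "0 < t" and C: "lyapunov 0 \<le> C" "dist2 0 \<le> C" and q: "L2_set q {..<m} \<le> \<rho>"
  shows "((\<Sum>i<n. \<bar>x t i\<bar>) + \<rho> * L2_set (r t) {..<m} - (\<Sum>i<n. \<bar>xb i\<bar>)) * sqrt t \<le> C / \<tau> + 2 * \<rho> * sqrt C"
proof (rule le_if_le_outside_negligible[OF negligible_exceptional t])
  \<comment> \<open>The interval is extended past \<open>t\<close> so that \<open>t\<close> is an
    interior point.\<close>
  have "continuous_on {0..t + 1} (\<lambda>t. ((\<Sum>i<n. \<bar>x t i\<bar>) + \<rho> * L2_set (r t) {..<m} - (\<Sum>i<n. \<bar>xb i\<bar>)) * sqrt t)"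
    unfolding L2_set_def
    by (intro continuous_intros abs_continuous_on_imp_continuous_on ac_x' ac_r) auto
  then show "isCont (\<lambda>t. ((\<Sum>i<n. \<bar>x t i\<bar>) + \<rho> * L2_set (r t) {..<m} - (\<Sum>i<n. \<bar>xb i\<bar>)) * sqrt t) t"
    by (rule continuous_on_interior) (use t in auto)
  fix s assume s: "0 < s" "s \<notin> exceptional"
  then have sN: "s \<notin> N" by (simp add: exceptional_def)
  have C0: "0 \<le> C" using C(2) dist2_nonneg[of 0] by linarith
  have \<rho>: "0 \<le> \<rho>" using q L2_set_nonneg[of q "{..<m}"] by linarith
  have sp: "sqrt (speed2 s) * sqrt s \<le> sqrt C"
    using speed2_decay[OF s] C(1) by (simp flip: real_sqrt_mult)
  have res: "L2_set (r s) {..<m} \<le> sqrt (speed2 s)"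
    unfolding L2_set_def speed2_def by (simp add: sum_nonneg)
  \<comment> \<open>Convexity at \<open>x\<close>: its own subgradient \<open>p\<close> bounds the
    excess over xb; the certificate is then split off.\<close>
  have "(\<Sum>i<n. \<bar>x s i\<bar>) - (\<Sum>i<n. \<bar>xb i\<bar>) \<le> (\<Sum>i<n. (x s i - xb i) * p s i)"
    unfolding sum_subtractf[symmetric]
  proof (rule sum_mono)
    fix i assume "i \<in> {..<n}"
    then show "\<bar>x s i\<bar> - \<bar>xb i\<bar> \<le> (x s i - xb i) * p s i"
      using sgn_set_subgradient[OF p_sgn[OF s(1) sN, of i], of "xb i"] by (simp add: algebra_simps)
  qed
  moreover have "(\<Sum>i<n. (x s i - xb i) * p s i) = (\<Sum>i<n. (x s i - xb i) * (p s i - pb i)) + (\<Sum>j<m. q j * r s j)"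
    unfolding sum_error_pb[symmetric] by (simp add: sum.distrib[symmetric] algebra_simps)
  moreover have "(\<Sum>i<n. (x s i - xb i) * (p s i - pb i)) \<le> sqrt (speed2 s) * sqrt C / \<tau>"
  proof -
    have "\<tau> * (\<Sum>i<n. (x s i - xb i) * (p s i - pb i)) \<le> dissipation s"
      using sum_nonneg[of "{..<m}" "\<lambda>j. (r s j)\<^sup>2"] by (simp add: dissipation_def)
    also have "\<dots> \<le> sqrt (speed2 s) * sqrt (dist2 0)" by (rule dissipation_le_speed[OF s(1) sN])
    also have "\<dots> \<le> sqrt (speed2 s) * sqrt C"
      using C(2) speed2_nonneg by (intro mult_left_mono) auto
    finally show ?thesis using tau by (simp add: field_simps)
  qed
  moreover have "(\<Sum>j<m. q j * r s j) \<le> \<rho> * sqrt (speed2 s)"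
  proof -
    have "(\<Sum>j<m. q j * r s j) \<le> L2_set q {..<m} * L2_set (r s) {..<m}"
      by (rule order_trans[OF _ L2_set_mult_ineq]) (auto intro!: sum_mono simp: abs_mult[symmetric])
    also have "\<dots> \<le> \<rho> * sqrt (speed2 s)"
      using q res \<rho> by (intro mult_mono) auto
    finally show ?thesis .
  qed
  moreover have "\<rho> * L2_set (r s) {..<m} \<le> \<rho> * sqrt (speed2 s)"
    using res \<rho> by (rule mult_left_mono)
  ultimately have main: "(\<Sum>i<n. \<bar>x s i\<bar>) + \<rho> * L2_set (r s) {..<m} - (\<Sum>i<n. \<bar>xb i\<bar>)
      \<le> sqrt (speed2 s) * sqrt C / \<tau> + 2 * \<rho> * sqrt (speed2 s)"
    by linarith
  then have "((\<Sum>i<n. \<bar>x s i\<bar>) + \<rho> * L2_set (r s) {..<m} - (\<Sum>i<n. \<bar>xb i\<bar>)) * sqrt s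
      \<le> (sqrt (speed2 s) * sqrt C / \<tau> + 2 * \<rho> * sqrt (speed2 s)) * sqrt s"
    by (rule mult_right_mono) (use s(1) in simp)
  also have "\<dots> = (sqrt (speed2 s) * sqrt s) * (sqrt C / \<tau> + 2 * \<rho>)"
    by (simp add: algebra_simps)
  also have "\<dots> \<le> sqrt C * (sqrt C / \<tau> + 2 * \<rho>)"
    using sp tau C0 \<rho> by (intro mult_right_mono) auto
  also have "\<dots> = C / \<tau> + 2 * \<rho> * sqrt C"
    using C0 by (simp add: algebra_simps)
  finally show "((\<Sum>i<n. \<bar>x s i\<bar>) + \<rho> * L2_set (r s) {..<m} - (\<Sum>i<n. \<bar>xb i\<bar>)) * sqrt s
     \<le> C / \<tau> + 2 * \<rho> * sqrt C" .
qed

end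

subsection \<open>Dual certificates and exact penalties\<close>

text \<open>Tychonoff's theorem. In the uses below the coordinates beyond the dimension are confined
  to {0}.\<close>

lemma compact_box_fun:
  fixes P :: "'i \<Rightarrow> 'a::topological_space set"
  assumes "\<And>i. compact (P i)"
  shows "compact {v. \<forall>i. v i \<in> P i}"
proof -
  have "compactin (product_topology (\<lambda>i. euclidean) UNIV) (PiE UNIV P)"
    unfolding compactin_PiE using assms by simp
  moreover have "PiE UNIV P = {v. \<forall>i. v i \<in> P i}" by (auto simp: PiE_iff)
  ultimately show ?thesis by (simp add: euclidean_product_topology)
qed

lemma continuous_on_mat_app:
  assumes "\<And>i. continuous_on S (\<lambda>v. f v i)"
  shows "continuous_on S (\<lambda>v. mat_app n a (f v) j)"
  unfolding mat_app_def by (intro continuous_intros assms)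

lemma continuous_on_L2_set:
  assumes "\<And>i. continuous_on S (\<lambda>v. f v i)"
  shows "continuous_on S (\<lambda>v. L2_set (f v) I)"
  unfolding L2_set_def by (intro continuous_intros assms)

lemma continuous_on_coordinate: "continuous_on S (\<lambda>v. v i)"
  by (rule continuous_on_product_then_coordinatewise[OF continuous_on_id])

lemma sgn_set_convex:
  assumes "p \<in> sgn_set s" "p' \<in> sgn_set s" "0 \<le> u" "u \<le> 1"
  shows "p + u * (p' - p) \<in> sgn_set s"
proof (cases "s = 0")
  case True
  then have "p \<in> {-1..1}" "p' \<in> {-1..1}" using assms by (auto simp: sgn_set_def)
  then have "(1 - u) *\<^sub>R p + u *\<^sub>R p' \<in> {-1..1}"
    using convexD_alt[OF convex_real_interval(5)] assms(3,4) by blast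
  then show ?thesis using True by (simp add: sgn_set_def algebra_simps)
qed (use assms in \<open>auto simp: sgn_set_def split: if_splits\<close>)

lemma compact_sgn_set: "compact (sgn_set s)"
  by (simp add: sgn_set_def)

text \<open>First variation at a minimum: the linear term decides for small \<open>s\<close>. If b <
  0, the chosen \<open>s\<close> gives s * c \<le> - b, so 2 * b + s * c is still negative.\<close>

lemma nonneg_if_quadratic_nonneg:
  fixes b c :: real
  assumes "\<And>s. 0 < s \<Longrightarrow> s \<le> 1 \<Longrightarrow> 0 \<le> 2 * s * b + s\<^sup>2 * c"
  shows "0 \<le> b"
proof (rule ccontr)
  assume b: "\<not> 0 \<le> b"
  define s where "s = min 1 (- b / (\<bar>c\<bar> + 1))"
  have s: "0 < s" "s \<le> 1" using b by (auto simp: s_def divide_neg_pos intro: divide_pos_pos)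
  have "s * (\<bar>c\<bar> + 1) \<le> (- b / (\<bar>c\<bar> + 1)) * (\<bar>c\<bar> + 1)"
    by (rule mult_right_mono) (auto simp: s_def)
  then have "s * (\<bar>c\<bar> + 1) \<le> - b" by (simp add: add_nonneg_eq_0_iff)
  moreover have "s * c \<le> s * (\<bar>c\<bar> + 1)" using s by (intro mult_left_mono) auto
  ultimately have "2 * b + s * c < 0" using b by linarith
  then have "s * (2 * b + s * c) < 0" using s by (simp add: mult_pos_neg)
  then show False using assms[OF s] by (simp add: algebra_simps power2_eq_square)
qed

text \<open>Minimise the distance between the subdifferential at \<open>xb\<close> and the image of the \<open>\<rho>\<close>-ball under
  the transpose. If the difference \<open>d\<close> of the two minimisers were nonzero, a small step from \<open>xb\<close> in
  the direction \<open>- d\<close> would decrease the penalised norm.\<close>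

lemma exact_penalty_certificate:
  assumes feas: "\<And>j. j < m \<Longrightarrow> mat_app n a xb j = y j" and \<rho>: "0 \<le> \<rho>"
    and pen: "\<And>v. (\<Sum>i<n. \<bar>xb i\<bar>) \<le> (\<Sum>i<n. \<bar>v i\<bar>) + \<rho> * L2_set (\<lambda>j. mat_app n a v j - y j) {..<m}"
  obtains q where "L2_set q {..<m} \<le> \<rho>" "\<And>i. i < n \<Longrightarrow> (\<Sum>j<m. a j i * q j) \<in> sgn_set (xb i)"
proof -
  define Aq where "Aq q i = (\<Sum>j<m. a j i * q j)" for q :: "nat \<Rightarrow> real" and i
  define P where "P = {p. \<forall>i. p i \<in> (if i < n then sgn_set (xb i) else {0})}"
  \<comment> \<open>The coordinate bounds follow from the norm bound (\<open>Q_mem\<close>); listing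
    them exhibits \<open>Q\<close> as a closed part of a compact box.\<close>
  define Q where "Q = {q :: nat \<Rightarrow> real. (\<forall>j. q j \<in> (if j < m then {-\<rho>..\<rho>} else {0})) \<and> L2_set q {..<m} \<le> \<rho>}"
  define F where "F = (\<lambda>(p, q). \<Sum>i<n. (p i - Aq q i)\<^sup>2)"
  have Q_mem: "q \<in> Q" if "\<forall>j\<ge>m. q j = 0" "L2_set q {..<m} \<le> \<rho>" for q
  proof -
    have "\<bar>q j\<bar> \<le> \<rho>" if "j < m" for j
    proof -
      have "\<bar>q j\<bar> \<le> L2_set (\<lambda>j. \<bar>q j\<bar>) {..<m}" by (rule member_le_L2_set) (use that in auto)
      also have "\<dots> = L2_set q {..<m}" by (simp add: L2_set_def)
      finally show ?thesis using \<open>L2_set q {..<m} \<le> \<rho>\<close> by linarith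
    qed
    then show ?thesis using that by (auto simp: Q_def abs_le_iff minus_le_iff)
  qed
  have Q_zero: "q j = 0" if "q \<in> Q" "m \<le> j" for q j
    using that by (auto simp: Q_def dest!: spec[of _ j])
  have P_D: "p i \<in> (if i < n then sgn_set (xb i) else {0})" if "p \<in> P" for p i
    using that by (simp only: P_def mem_Collect_eq)
  have "compact P" unfolding P_def by (rule compact_box_fun) (simp add: compact_sgn_set)
  moreover have "compact Q"
  proof -
    have "closed {q :: nat \<Rightarrow> real. L2_set q {..<m} \<le> \<rho>}"
      by (intro closed_Collect_le continuous_on_L2_set continuous_on_coordinate continuous_on_const)
    moreover have "compact {q :: nat \<Rightarrow> real. \<forall>j. q j \<in> (if j < m then {-\<rho>..\<rho>} else {0})}"
      by (rule compact_box_fun) simp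
    ultimately have "compact ({q. \<forall>j. q j \<in> (if j < m then {-\<rho>..\<rho>} else {0})} \<inter> {q :: nat \<Rightarrow> real. L2_set q {..<m} \<le> \<rho>})"
      by (intro compact_Int_closed)
    then show ?thesis by (simp add: Q_def Collect_conj_eq)
  qed
  ultimately have "compact (P \<times> Q)" by (rule compact_Times)
  moreover have "P \<times> Q \<noteq> {}"
  proof -
    have "(\<lambda>i. if i < n then sgn (xb i) else 0) \<in> P" by (auto simp: P_def sgn_set_def)
    moreover have "(\<lambda>j. 0) \<in> Q" using \<rho> by (auto simp: Q_def L2_set_def)
    ultimately show ?thesis by blast
  qed
  moreover have "continuous_on (P \<times> Q) F"
    unfolding F_def Aq_def case_prod_unfold
    by (intro continuous_intros continuous_on_product_then_coordinatewise[OF continuous_on_fst[OF continuous_on_id]]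
        continuous_on_product_then_coordinatewise[OF continuous_on_snd[OF continuous_on_id]])
  ultimately obtain w where w: "w \<in> P \<times> Q" "\<forall>u\<in>P \<times> Q. F w \<le> F u"
    using continuous_attains_inf by blast
  define p0 q0 where "p0 = fst w" and "q0 = snd w"
  have pq0: "p0 \<in> P" "q0 \<in> Q" and min: "\<And>p q. p \<in> P \<Longrightarrow> q \<in> Q \<Longrightarrow> F (p0, q0) \<le> F (p, q)"
    using w by (auto simp: p0_def q0_def)
  define d where "d i = p0 i - Aq q0 i" for i
  have Aq_lin: "Aq (\<lambda>j. q j + s * (q' j - q j)) i = Aq q i + s * (Aq q' i - Aq q i)" for q q' s i
    by (simp add: Aq_def sum_distrib_left sum.distrib[symmetric] sum_subtractf[symmetric] algebra_simps)
  \<comment> \<open>First-order condition at a minimiser over a convex set: the segment towards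
    \<open>(p, q)\<close> stays in the set, so the term linear in its parameter is
    nonnegative.\<close>
  have variational: "(\<Sum>i<n. (d i)\<^sup>2) \<le> (\<Sum>i<n. d i * p i) - (\<Sum>i<n. d i * Aq q i)" if "p \<in> P" "q \<in> Q" for p q
  proof -
    define g where "g i = (p i - Aq q i) - d i" for i
    have "0 \<le> (\<Sum>i<n. d i * g i)"
    proof (rule nonneg_if_quadratic_nonneg)
      fix s :: real assume s: "0 < s" "s \<le> 1"
      let ?p = "\<lambda>i. p0 i + s * (p i - p0 i)" and ?q = "\<lambda>j. q0 j + s * (q j - q0 j)"
      have "?p \<in> P"
        unfolding P_def mem_Collect_eq
      proof
        fix i
        show "?p i \<in> (if i < n then sgn_set (xb i) else {0})"
          using sgn_set_convex[of "p0 i" "xb i" "p i" s] P_D[OF pq0(1), of i] P_D[OF that(1), of i] s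
          by (cases "i < n") simp_all
      qed
      moreover have "?q \<in> Q"
      proof -
        have "L2_set ?q {..<m} = L2_set (\<lambda>j. (1 - s) * q0 j + s * q j) {..<m}"
          by (simp add: algebra_simps)
        also have "\<dots> \<le> L2_set (\<lambda>j. (1 - s) * q0 j) {..<m} + L2_set (\<lambda>j. s * q j) {..<m}"
          by (rule L2_set_triangle_ineq)
        also have "\<dots> = (1 - s) * L2_set q0 {..<m} + s * L2_set q {..<m}"
          using s by (simp add: L2_set_right_distrib)
        also have "\<dots> \<le> (1 - s) * \<rho> + s * \<rho>"
          using pq0(2) that(2) s by (intro add_mono mult_left_mono) (simp_all add: Q_def)
        finally have L: "L2_set ?q {..<m} \<le> \<rho>" by (simp add: algebra_simps)
        have "\<forall>j\<ge>m. ?q j = 0" using Q_zero[OF pq0(2)] Q_zero[OF that(2)] by simp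
        then show ?thesis using L by (intro Q_mem)
      qed
      ultimately have "F (p0, q0) \<le> F (?p, ?q)" by (rule min)
      also have "F (?p, ?q) = (\<Sum>i<n. (d i + s * g i)\<^sup>2)"
        unfolding F_def prod.case Aq_lin
        by (rule sum.cong) (simp_all add: d_def g_def algebra_simps)
      also have "\<dots> = F (p0, q0) + 2 * s * (\<Sum>i<n. d i * g i) + s\<^sup>2 * (\<Sum>i<n. (g i)\<^sup>2)"
        unfolding F_def prod.case d_def[symmetric] sum_distrib_left sum.distrib[symmetric]
        by (rule sum.cong) (simp_all add: power2_eq_square algebra_simps)
      finally show "0 \<le> 2 * s * (\<Sum>i<n. d i * g i) + s\<^sup>2 * (\<Sum>i<n. (g i)\<^sup>2)" by linarith
    qed
    also have "(\<Sum>i<n. d i * g i) = (\<Sum>i<n. d i * p i) - (\<Sum>i<n. d i * Aq q i) - (\<Sum>i<n. (d i)\<^sup>2)"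
      unfolding sum_subtractf[symmetric]
      by (rule sum.cong) (simp_all add: g_def power2_eq_square algebra_simps)
    finally show ?thesis by simp
  qed
  \<comment> \<open>The subgradient with the smallest product with \<open>d\<close>; it gives the
    one-sided slope of the norm in the direction - d.\<close>
  define p where "p i = (if i < n then if xb i = 0 then - sgn (d i) else sgn (xb i) else 0)" for i
  have "p \<in> P" by (auto simp: P_def p_def sgn_set_def sgn_if)
  define L where "L = L2_set (mat_app n a d) {..<m}"
  \<comment> \<open>The point of the ball whose image is best aligned with \<open>d\<close>. For L =
    0 division by zero yields 0, which still satisfies the norm bound and has pairing \<rho> *
    L.\<close>
  define q where "q j = (if j < m then \<rho> / L * mat_app n a d j else 0)" for j
  have L0: "0 \<le> L" by (simp add: L_def)
  have Lq: "L2_set q {..<m} \<le> \<rho>"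
  proof -
    have "L2_set q {..<m} = L2_set (\<lambda>j. \<rho> / L * mat_app n a d j) {..<m}"
      by (rule L2_set_cong) (auto simp: q_def)
    also have "\<dots> = \<rho> / L * L" 
      using L2_set_right_distrib[of "\<rho> / L" "mat_app n a d" "{..<m}"] \<rho> L0 unfolding L_def[symmetric] by simp
    also have "\<dots> \<le> \<rho>" using \<rho> by simp
    finally show ?thesis .
  qed
  have "q \<in> Q" using Lq by (intro Q_mem) (auto simp: q_def)
  have "(\<Sum>i<n. d i * Aq q i) = \<rho> * L"
  proof -
    have "(\<Sum>i<n. d i * Aq q i) = (\<Sum>j<m. q j * mat_app n a d j)"
      unfolding Aq_def by (rule sum_mat_app_adjoint)
    also have "\<dots> = \<rho> / L * (\<Sum>j<m. (mat_app n a d j)\<^sup>2)"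
      by (simp add: q_def sum_distrib_left power2_eq_square mult.assoc)
    also have "(\<Sum>j<m. (mat_app n a d j)\<^sup>2) = L\<^sup>2"
      by (simp add: L_def L2_set_def sum_nonneg)
    finally show ?thesis by (simp add: power2_eq_square)
  qed
  with variational[OF \<open>p \<in> P\<close> \<open>q \<in> Q\<close>] have var: "(\<Sum>i<n. (d i)\<^sup>2) \<le> (\<Sum>i<n. d i * p i) - \<rho> * L"
    by simp
  \<comment> \<open>So small that no nonzero entry of xb changes sign along the step. The added 1
    keeps denominators positive; the inserted 1 covers xb = 0.\<close>
  define s where "s = Min (insert 1 ((\<lambda>i. \<bar>xb i\<bar> / (\<bar>d i\<bar> + 1)) ` {i. i < n \<and> xb i \<noteq> 0}))"
  have s0: "0 < s" unfolding s_def by (subst Min_gr_iff) auto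
  have s_le: "s * \<bar>d i\<bar> \<le> \<bar>xb i\<bar>" if "i < n" "xb i \<noteq> 0" for i
  proof -
    have "s \<le> \<bar>xb i\<bar> / (\<bar>d i\<bar> + 1)" unfolding s_def by (rule Min_le) (use that in auto)
    then have "s * (\<bar>d i\<bar> + 1) \<le> \<bar>xb i\<bar>" by (simp add: pos_le_divide_eq add_nonneg_pos)
    then show ?thesis using s0 by (simp add: algebra_simps)
  qed
  have abs_eq: "\<bar>xb i - s * d i\<bar> = \<bar>xb i\<bar> - s * (d i * p i)" if "i < n" for i
  proof (cases "xb i = 0")
    case True
    then show ?thesis using that s0 by (simp add: p_def abs_mult abs_sgn sgn_mult)
  next
    case False
    have "\<bar>s * d i\<bar> \<le> \<bar>xb i\<bar>" using s_le[OF that False] s0 by (simp add: abs_mult)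
    then show ?thesis using False that by (cases "xb i > 0") (auto simp: p_def sgn_if abs_if split: if_splits)
  qed
  have "(\<Sum>i<n. \<bar>xb i\<bar>) \<le> (\<Sum>i<n. \<bar>xb i - s * d i\<bar>) + \<rho> * L2_set (\<lambda>j. mat_app n a (\<lambda>i. xb i - s * d i) j - y j) {..<m}"
    by (rule pen)
  also have "L2_set (\<lambda>j. mat_app n a (\<lambda>i. xb i - s * d i) j - y j) {..<m} = L2_set (\<lambda>j. s * mat_app n a d j) {..<m}"
  proof -
    have "mat_app n a (\<lambda>i. xb i - s * d i) j - y j = - (s * mat_app n a d j)" if "j < m" for j
      using feas[OF that] by (simp add: mat_app_diff) (simp add: mat_app_def sum_distrib_left ac_simps)
    then show ?thesis by (simp add: L2_set_def)
  qed
  also have "\<dots> = s * L" using s0 by (simp add: L2_set_right_distrib L_def)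
  also have "(\<Sum>i<n. \<bar>xb i - s * d i\<bar>) = (\<Sum>i<n. \<bar>xb i\<bar>) - s * (\<Sum>i<n. d i * p i)"
    by (simp add: abs_eq sum_subtractf sum_distrib_left)
  finally have "s * ((\<Sum>i<n. d i * p i) - \<rho> * L) \<le> 0" by (simp add: algebra_simps)
  then have "(\<Sum>i<n. d i * p i) - \<rho> * L \<le> 0" using s0 by (simp add: mult_le_0_iff)
  with var have "(\<Sum>i<n. (d i)\<^sup>2) \<le> 0" by linarith
  then have "(\<Sum>i<n. (d i)\<^sup>2) = 0" by (intro antisym sum_nonneg) auto
  then have "d i = 0" if "i < n" for i using that by (subst (asm) sum_nonneg_eq_0_iff) auto
  then have "Aq q0 i \<in> sgn_set (xb i)" if "i < n" for i
    using P_D[OF pq0(1), of i] that by (simp add: d_def)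
  then show thesis using that[of q0] pq0(2) by (simp add: Aq_def Q_def)
qed

section \<open>Existence of the exact penalty and of the uniqueness gap\<close>

lemma mat_app_cong: "(\<And>i. i < n \<Longrightarrow> u i = v i) \<Longrightarrow> mat_app n a u j = mat_app n a v j"
  unfolding mat_app_def by (rule sum.cong) auto

text \<open>Subtracting the right inverse \<open>b\<close> applied to the residual makes any
  \<open>v\<close> feasible, and changes its l1 norm by at most the entry sum of \<open>b\<close>
  times the norm of the residual. That entry sum is the penalty.\<close>

lemma exact_penalty_exists:
  fixes b :: "nat \<Rightarrow> nat \<Rightarrow> real"
  assumes inv: "\<And>w j. j < m \<Longrightarrow> mat_app n a (mat_app m b w) j = w j"
    and min: "\<And>v. (\<And>j. j < m \<Longrightarrow> mat_app n a v j = y j) \<Longrightarrow> (\<Sum>i<n. \<bar>xb i\<bar>) \<le> (\<Sum>i<n. \<bar>v i\<bar>)"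
  obtains \<rho> where "0 \<le> \<rho>"
    "\<And>v. (\<Sum>i<n. \<bar>xb i\<bar>) \<le> (\<Sum>i<n. \<bar>v i\<bar>) + \<rho> * L2_set (\<lambda>j. mat_app n a v j - y j) {..<m}"
proof
  show "0 \<le> (\<Sum>i<n. \<Sum>j<m. \<bar>b i j\<bar>)" by (intro sum_nonneg) auto
  fix v :: "nat \<Rightarrow> real"
  define w where "w j = mat_app n a v j - y j" for j
  have w_le: "\<bar>w j\<bar> \<le> L2_set w {..<m}" if "j < m" for j
  proof -
    have "\<bar>w j\<bar> \<le> L2_set (\<lambda>j. \<bar>w j\<bar>) {..<m}" by (rule member_le_L2_set) (use that in auto)
    then show ?thesis by (simp add: L2_set_def)
  qed
  have "(\<Sum>i<n. \<bar>xb i\<bar>) \<le> (\<Sum>i<n. \<bar>v i - mat_app m b w i\<bar>)"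
    by (rule min) (simp add: mat_app_diff inv w_def)
  also have "\<dots> \<le> (\<Sum>i<n. \<bar>v i\<bar> + (\<Sum>j<m. \<bar>b i j\<bar>) * L2_set w {..<m})"
  proof (rule sum_mono)
    fix i
    have "\<bar>mat_app m b w i\<bar> \<le> (\<Sum>j<m. \<bar>b i j\<bar> * \<bar>w j\<bar>)"
      unfolding mat_app_def by (rule order_trans[OF sum_abs]) (simp add: abs_mult)
    also have "\<dots> \<le> (\<Sum>j<m. \<bar>b i j\<bar> * L2_set w {..<m})"
      by (intro sum_mono mult_left_mono w_le) auto
    finally have "\<bar>mat_app m b w i\<bar> \<le> (\<Sum>j<m. \<bar>b i j\<bar>) * L2_set w {..<m}"
      by (simp add: sum_distrib_right)
    then show "\<bar>v i - mat_app m b w i\<bar> \<le> \<bar>v i\<bar> + (\<Sum>j<m. \<bar>b i j\<bar>) * L2_set w {..<m}"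
      using abs_triangle_ineq4[of "v i" "mat_app m b w i"] by linarith
  qed
  also have "\<dots> = (\<Sum>i<n. \<bar>v i\<bar>) + (\<Sum>i<n. \<Sum>j<m. \<bar>b i j\<bar>) * L2_set w {..<m}"
    by (simp add: sum.distrib sum_distrib_right)
  finally show "(\<Sum>i<n. \<bar>xb i\<bar>) \<le> (\<Sum>i<n. \<bar>v i\<bar>)
      + (\<Sum>i<n. \<Sum>j<m. \<bar>b i j\<bar>) * L2_set (\<lambda>j. mat_app n a v j - y j) {..<m}"
    unfolding w_def .
qed

text \<open>The extra 1 in the weight makes infeasible points strictly worse than xb; uniqueness
  does so for feasible ones at distance \<delta>. Compactness makes this uniform where the l1 norm
  exceeds that of xb by at most 1; beyond, the gap is at least 1.\<close>

lemma uniqueness_gap_exists: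
  assumes \<rho>: "0 \<le> \<rho>" and \<delta>: "0 < \<delta>"
    and pen: "\<And>v. (\<Sum>i<n. \<bar>xb i\<bar>) \<le> (\<Sum>i<n. \<bar>v i\<bar>) + \<rho> * L2_set (\<lambda>j. mat_app n a v j - y j) {..<m}"
    and uniq: "\<And>v. (\<And>j. j < m \<Longrightarrow> mat_app n a v j = y j) \<Longrightarrow> (\<Sum>i<n. \<bar>v i\<bar>) \<le> (\<Sum>i<n. \<bar>xb i\<bar>)
      \<Longrightarrow> (\<And>i. i < n \<Longrightarrow> v i = xb i)"
  obtains \<kappa> where "0 < \<kappa>" "\<And>v. \<delta> \<le> L2_set (\<lambda>i. v i - xb i) {..<n} \<Longrightarrow>
    (\<Sum>i<n. \<bar>xb i\<bar>) + \<kappa> \<le> (\<Sum>i<n. \<bar>v i\<bar>) + (\<rho> + 1) * L2_set (\<lambda>j. mat_app n a v j - y j) {..<m}"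
proof -
  define l1 where "l1 v = (\<Sum>i<n. \<bar>v i\<bar>)" for v :: "nat \<Rightarrow> real"
  define R where "R v = L2_set (\<lambda>j. mat_app n a v j - y j) {..<m}" for v
  define J where "J v = l1 v + (\<rho> + 1) * R v" for v
  define S where "S = {v. \<forall>i. v i \<in> (if i < n then {-(l1 xb + 1)..l1 xb + 1} else {0})}
    \<inter> {v. \<delta> \<le> L2_set (\<lambda>i. v i - xb i) {..<n}}"
  have R0: "0 \<le> R v" for v by (simp add: R_def)
  have l1_cont: "continuous_on T l1" for T
    unfolding l1_def by (intro continuous_intros continuous_on_coordinate)
  have J_cont: "continuous_on T J" for T
    unfolding J_def R_def
    by (intro continuous_intros l1_cont continuous_on_L2_set continuous_on_mat_app continuous_on_coordinate)
  have J_gt: "l1 xb < J v" if "\<delta> \<le> L2_set (\<lambda>i. v i - xb i) {..<n}" for v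
  proof (rule ccontr)
    assume "\<not> l1 xb < J v"
    then have "l1 v + \<rho> * R v + R v \<le> l1 xb" by (simp add: J_def algebra_simps)
    moreover have "l1 xb \<le> l1 v + \<rho> * R v" using pen by (simp add: l1_def R_def)
    moreover have "0 \<le> \<rho> * R v" using R0 \<rho> by simp
    ultimately have R: "R v = 0" and l: "l1 v \<le> l1 xb" using R0[of v] by linarith+
    have "mat_app n a v j = y j" if "j < m" for j
      using R that unfolding R_def by (subst (asm) L2_set_eq_0_iff) auto
    then have "v i = xb i" if "i < n" for i
      using uniq[of v i] l that unfolding l1_def by blast
    then have "L2_set (\<lambda>i. v i - xb i) {..<n} = 0" by (simp add: L2_set_eq_0_iff)
    then show False using that \<delta> by simp
  qed
  have "compact S"
    unfolding S_def
    by (intro compact_Int_closed compact_box_fun closed_Collect_le continuous_on_L2_set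
        continuous_on_coordinate continuous_on_const continuous_on_diff) simp
  have "\<exists>\<kappa>>0. \<kappa> \<le> 1 \<and> (\<forall>v\<in>S. l1 xb + \<kappa> \<le> J v)"
  proof (cases "S = {}")
    case True
    then show ?thesis by (intro exI[of _ 1]) simp
  next
    case False
    then obtain w where w: "w \<in> S" "\<forall>v\<in>S. J w \<le> J v"
      using continuous_attains_inf[OF \<open>compact S\<close> _ J_cont] by blast
    then have "l1 xb < J w" using J_gt by (auto simp: S_def)
    with w(2) show ?thesis by (intro exI[of _ "min 1 (J w - l1 xb)"]) force
  qed
  then obtain \<kappa> where \<kappa>: "0 < \<kappa>" "\<kappa> \<le> 1" "\<And>v. v \<in> S \<Longrightarrow> l1 xb + \<kappa> \<le> J v" by blast
  have "l1 xb + \<kappa> \<le> J v" if v: "\<delta> \<le> L2_set (\<lambda>i. v i - xb i) {..<n}" for v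
  proof (cases "l1 v \<le> l1 xb + 1")
    case True
    \<comment> \<open>Entries from \<open>n\<close> on are cut off to enter the compact set
      \<open>S\<close>; none of the quantities sees them.\<close>
    define v' where "v' i = (if i < n then v i else 0)" for i
    have "\<bar>v i\<bar> \<le> l1 v" if "i < n" for i
      unfolding l1_def by (rule member_le_sum[where f = "\<lambda>i. \<bar>v i\<bar>"]) (use that in auto)
    then have "v i \<in> {-(l1 xb + 1)..l1 xb + 1}" if "i < n" for i
      using True that unfolding atLeastAtMost_iff by (meson abs_le_D1 abs_le_D2 minus_le_iff order_trans)
    moreover have "L2_set (\<lambda>i. v' i - xb i) {..<n} = L2_set (\<lambda>i. v i - xb i) {..<n}"
      by (rule L2_set_cong) (auto simp: v'_def)
    ultimately have "v' \<in> S" using v unfolding S_def by (simp add: v'_def)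
    moreover have "mat_app n a v' j = mat_app n a v j" for j
      by (rule mat_app_cong) (simp add: v'_def)
    then have "J v' = J v" by (simp add: J_def R_def l1_def v'_def)
    ultimately show ?thesis using \<kappa>(3) by metis
  next
    case False
    moreover have "0 \<le> (\<rho> + 1) * R v" using R0 \<rho> by simp
    ultimately show ?thesis using \<kappa>(2) by (simp add: J_def)
  qed
  then show thesis using that[of \<kappa>] \<kappa>(1) by (simp add: J_def R_def l1_def)
qed

subsection \<open>Settling time\<close>

text \<open>Bounds \<open>lyapunov 0\<close> term by term, with \<alpha> the l1 norm of x0, L the
  norm of A A^T and \<beta> that of y: |A x0 - y| \<le> sqrt L * \<alpha> + \<beta>, |xb| \<le>
  \<rho> * \<beta> and |q| \<le> \<rho>.\<close>

definition energy_bound :: "real \<Rightarrow> real \<Rightarrow> real \<Rightarrow> real \<Rightarrow> real \<Rightarrow> real" where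
  "energy_bound \<alpha> L \<tau> \<beta> \<rho> = \<tau> * \<alpha> + (sqrt L * \<alpha> + \<beta>)\<^sup>2 / 2 + (\<alpha> + \<rho> * \<beta>)\<^sup>2 + (\<tau> * \<rho>)\<^sup>2"

text \<open>The time at which the bound of \<open>penalty_gap_le\<close>, divided by sqrt t, has
  come down to \<kappa>.\<close>

definition settling_time :: "real \<Rightarrow> real \<Rightarrow> real \<Rightarrow> real \<Rightarrow> real \<Rightarrow> real \<Rightarrow> real" where
  "settling_time \<alpha> L \<tau> \<beta> \<rho> \<kappa> =
    ((energy_bound \<alpha> L \<tau> \<beta> \<rho> / \<tau> + 2 * \<rho> * sqrt (energy_bound \<alpha> L \<tau> \<beta> \<rho>)) / \<kappa>)\<^sup>2"

lemma L2_set_uminus: "L2_set (\<lambda>i. - f i) I = L2_set f I"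
  by (simp add: L2_set_def)

lemma L2_set_power2: "(L2_set f I)\<^sup>2 = (\<Sum>i\<in>I. (f i)\<^sup>2)"
  by (simp add: L2_set_def sum_nonneg)

lemma L2_set_diff_le: "L2_set (\<lambda>i. f i - g i) I \<le> L2_set f I + L2_set g I"
  using L2_set_triangle_ineq[of f "\<lambda>i. - g i" I] by (simp add: L2_set_uminus)

context l1_flow
begin

lemma convergence:
  assumes feas: "\<And>j. j < m \<Longrightarrow> mat_app n a xb j = y j" and \<rho>: "0 \<le> \<rho>" and \<kappa>: "0 < \<kappa>" and L: "0 \<le> L"
    and pen: "\<And>v. (\<Sum>i<n. \<bar>xb i\<bar>) \<le> (\<Sum>i<n. \<bar>v i\<bar>) + \<rho> * L2_set (\<lambda>j. mat_app n a v j - y j) {..<m}"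
    and gap: "\<And>v. \<delta> \<le> L2_set (\<lambda>i. v i - xb i) {..<n} \<Longrightarrow>
      (\<Sum>i<n. \<bar>xb i\<bar>) + \<kappa> \<le> (\<Sum>i<n. \<bar>v i\<bar>) + \<rho> * L2_set (\<lambda>j. mat_app n a v j - y j) {..<m}"
    and op: "L2_set (mat_app n a (x 0)) {..<m} \<le> sqrt L * L2_set (x 0) {..<n}"
    and t: "settling_time (\<Sum>i<n. \<bar>x 0 i\<bar>) L \<tau> (L2_set y {..<m}) \<rho> \<kappa> < t"
  shows "L2_set (\<lambda>i. x t i - xb i) {..<n} < \<delta>"
proof -
  obtain q where q: "L2_set q {..<m} \<le> \<rho>" "\<And>i. i < n \<Longrightarrow> (\<Sum>j<m. a j i * q j) \<in> sgn_set (xb i)"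
    using exact_penalty_certificate[of m n a xb y \<rho>, OF feas \<rho> pen] by blast
  interpret l1_flow_with_equilibrium n m a y \<tau> x z x' p N xb q
    by standard (use feas q(2) in auto)
  define \<alpha> \<beta> where "\<alpha> = (\<Sum>i<n. \<bar>x 0 i\<bar>)" and "\<beta> = L2_set y {..<m}"
  define C where "C = energy_bound \<alpha> L \<tau> \<beta> \<rho>"
  have \<alpha>0: "0 \<le> \<alpha>" and \<beta>0: "0 \<le> \<beta>" by (auto simp: \<alpha>_def \<beta>_def sum_nonneg)
  have x0: "L2_set (x 0) {..<n} \<le> \<alpha>"
    unfolding \<alpha>_def by (rule L2_set_le_sum_abs)
  have "L2_set xb {..<n} \<le> (\<Sum>i<n. \<bar>xb i\<bar>)" by (rule L2_set_le_sum_abs)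
  \<comment> \<open>The penalty inequality at the point 0 bounds the minimiser without a factor that
    depends on the dimension.\<close>
  also have "\<dots> \<le> \<rho> * \<beta>"
    using pen[of "\<lambda>i. 0"] by (simp add: mat_app_def L2_set_uminus \<beta>_def)
  finally have "L2_set (\<lambda>i. x 0 i - xb i) {..<n} \<le> \<alpha> + \<rho> * \<beta>"
    using L2_set_diff_le[of "x 0" xb "{..<n}"] x0 by linarith
  then have "(L2_set (\<lambda>i. x 0 i - xb i) {..<n})\<^sup>2 \<le> (\<alpha> + \<rho> * \<beta>)\<^sup>2"
    by (intro power_mono) auto
  moreover have "(\<tau> * L2_set q {..<m})\<^sup>2 \<le> (\<tau> * \<rho>)\<^sup>2"
    using q(1) tau by (intro power_mono mult_left_mono) auto
  moreover have "dist2 0 = (L2_set (\<lambda>i. x 0 i - xb i) {..<n})\<^sup>2 + (\<tau> * L2_set q {..<m})\<^sup>2"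
    by (simp add: dist2_def L2_set_power2 power_mult_distrib sum_distrib_left z0)
  ultimately have dist: "dist2 0 \<le> (\<alpha> + \<rho> * \<beta>)\<^sup>2 + (\<tau> * \<rho>)\<^sup>2" by linarith
  have "L2_set (r 0) {..<m} \<le> L2_set (mat_app n a (x 0)) {..<m} + \<beta>"
    unfolding r_def[abs_def] \<beta>_def by (rule L2_set_diff_le)
  also have "\<dots> \<le> sqrt L * \<alpha> + \<beta>"
    using op mult_left_mono[OF x0, of "sqrt L"] L by simp
  finally have "(L2_set (r 0) {..<m})\<^sup>2 \<le> (sqrt L * \<alpha> + \<beta>)\<^sup>2"
    by (intro power_mono) auto
  \<comment> \<open>The initial value z = 0 removes the indefinite product of z and r.\<close>
  moreover have "lyapunov 0 = \<tau> * \<alpha> + (L2_set (r 0) {..<m})\<^sup>2 / 2 + dist2 0"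
    by (simp add: lyapunov_def L2_set_power2 sum_divide_distrib \<alpha>_def z0)
  ultimately have ly: "lyapunov 0 \<le> C" unfolding C_def energy_bound_def using dist by linarith
  have "0 \<le> \<tau> * \<alpha> + (sqrt L * \<alpha> + \<beta>)\<^sup>2 / 2" using tau \<alpha>0 by simp
  then have dC: "dist2 0 \<le> C" unfolding C_def energy_bound_def using dist by linarith
  then have C0: "0 \<le> C" using dist2_nonneg[of 0] by linarith
  define K where "K = C / \<tau> + 2 * \<rho> * sqrt C"
  have K0: "0 \<le> K" using C0 tau \<rho> by (simp add: K_def)
  have tK: "(K / \<kappa>)\<^sup>2 < t"
    using t by (simp add: settling_time_def K_def C_def \<alpha>_def \<beta>_def)
  then have t0: "0 < t" using zero_le_power2[of "K / \<kappa>"] by linarith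
  have "K / \<kappa> < sqrt t" using tK by (simp add: real_less_rsqrt)
  then have K: "K < \<kappa> * sqrt t" using \<kappa> by (simp add: field_simps)
  show ?thesis
  proof (rule ccontr)
    assume "\<not> ?thesis"
    then have "\<kappa> \<le> (\<Sum>i<n. \<bar>x t i\<bar>) + \<rho> * L2_set (r t) {..<m} - (\<Sum>i<n. \<bar>xb i\<bar>)"
      using gap[of "x t"] by (simp add: r_def[abs_def])
    then have "\<kappa> * sqrt t \<le> ((\<Sum>i<n. \<bar>x t i\<bar>) + \<rho> * L2_set (r t) {..<m} - (\<Sum>i<n. \<bar>xb i\<bar>)) * sqrt t"
      by (rule mult_right_mono) (use t0 in simp)
    also have "\<dots> \<le> K" unfolding K_def by (rule penalty_gap_le[OF t0 ly dC q(1)])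
    finally show False using K by linarith
  qed
qed

end

subsection \<open>Vectors and matrices\<close>

lemma l1_norm_eq: "v \<in> carrier_vec n \<Longrightarrow> l1_norm v = (\<Sum>i<n. \<bar>v $ i\<bar>)"
  unfolding l1_norm_def by (drule carrier_vecD) simp

lemma l2_norm_eq: "v \<in> carrier_vec n \<Longrightarrow> l2_norm v = L2_set (($) v) {..<n}"
  unfolding l2_norm_def L2_set_def scalar_prod_def
  by (drule carrier_vecD) (simp add: power2_eq_square lessThan_atLeast0)

lemma mult_mat_vec_eq_mat_app:
  assumes "A \<in> carrier_mat m n" "v \<in> carrier_vec n" "j < m"
  shows "(A *\<^sub>v v) $ j = mat_app n (\<lambda>j i. A $$ (j, i)) (($) v) j"
  using carrier_matD[OF assms(1)] carrier_vecD[OF assms(2)] assms(3)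
  unfolding mat_app_def lessThan_atLeast0 by (auto simp: scalar_prod_def)

lemma transpose_mult_mat_vec_index:
  assumes "A \<in> carrier_mat m n" "w \<in> carrier_vec m" "i < n"
  shows "(A\<^sup>T *\<^sub>v w) $ i = (\<Sum>j<m. A $$ (j, i) * w $ j)"
  using carrier_matD[OF assms(1)] carrier_vecD[OF assms(2)] assms(3)
  unfolding lessThan_atLeast0 by (auto simp: scalar_prod_def)

section \<open>Euclidean and operator norms\<close>

lemma l2_norm_nonneg: "0 \<le> l2_norm v"
  unfolding l2_norm_eq[OF carrier_vec_dim_vec] by simp

lemma l2_norm_smult: "l2_norm (c \<cdot>\<^sub>v v) = \<bar>c\<bar> * l2_norm v"
proof -
  have "l2_norm (c \<cdot>\<^sub>v v) = L2_set (($) (c \<cdot>\<^sub>v v)) {..<dim_vec v}"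
    by (rule l2_norm_eq) auto
  also have "\<dots> = L2_set (\<lambda>i. \<bar>c\<bar> * v $ i) {..<dim_vec v}"
    unfolding L2_set_def by (intro arg_cong[where f = sqrt] sum.cong) (auto simp: power_mult_distrib)
  also have "\<dots> = \<bar>c\<bar> * l2_norm v"
    unfolding l2_norm_eq[OF carrier_vec_dim_vec[of v]] by (rule L2_set_right_distrib[symmetric]) simp
  finally show ?thesis .
qed

lemma scalar_prod_le_l2_norm:
  assumes "u \<in> carrier_vec n" "v \<in> carrier_vec n"
  shows "u \<bullet> v \<le> l2_norm u * l2_norm v"
proof -
  have "u \<bullet> v = (\<Sum>i<n. u $ i * v $ i)"
    unfolding scalar_prod_def using carrier_vecD[OF assms(2)] by (simp add: lessThan_atLeast0)
  also have "\<dots> \<le> (\<Sum>i<n. \<bar>u $ i\<bar> * \<bar>v $ i\<bar>)"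
    by (rule sum_mono) (simp add: abs_mult[symmetric])
  also have "\<dots> \<le> L2_set (($) u) {..<n} * L2_set (($) v) {..<n}"
    by (rule L2_set_mult_ineq)
  finally show ?thesis unfolding l2_norm_eq[OF assms(1)] l2_norm_eq[OF assms(2)] .
qed

text \<open>The supremum in \<open>mat_norm\<close> is informative only for a bounded set; the sum
  of all absolute entries is a crude but sufficient bound.\<close>

lemma bdd_above_mat_norm:
  "bdd_above ((\<lambda>v. l2_norm (M *\<^sub>v v)) ` {v \<in> carrier_vec (dim_col M). l2_norm v \<le> 1})"
proof (rule bdd_aboveI2)
  fix v assume v: "v \<in> {v \<in> carrier_vec (dim_col M). l2_norm v \<le> 1}"
  have v1: "\<bar>v $ i\<bar> \<le> 1" if "i < dim_col M" for i
  proof -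
    have "\<bar>v $ i\<bar> \<le> L2_set (\<lambda>i. \<bar>v $ i\<bar>) {..<dim_col M}"
      by (rule member_le_L2_set) (use that in auto)
    also have "\<dots> = l2_norm v" using v by (simp add: l2_norm_eq[of v "dim_col M"] L2_set_def)
    finally show ?thesis using v by simp
  qed
  have "l2_norm (M *\<^sub>v v) = L2_set (($) (M *\<^sub>v v)) {..<dim_row M}"
    by (rule l2_norm_eq) (rule carrier_vecI, simp)
  also have "\<dots> \<le> (\<Sum>j<dim_row M. \<bar>(M *\<^sub>v v) $ j\<bar>)" by (rule L2_set_le_sum_abs)
  also have "\<dots> \<le> (\<Sum>j<dim_row M. \<Sum>i<dim_col M. \<bar>M $$ (j, i)\<bar>)"
  proof (rule sum_mono)
    fix j assume "j \<in> {..<dim_row M}"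
    then have "(M *\<^sub>v v) $ j = (\<Sum>i<dim_col M. M $$ (j, i) * v $ i)"
      using mult_mat_vec_eq_mat_app[of M "dim_row M" "dim_col M" v j] v by (simp add: mat_app_def)
    also have "\<bar>\<dots>\<bar> \<le> (\<Sum>i<dim_col M. \<bar>M $$ (j, i)\<bar> * \<bar>v $ i\<bar>)"
      by (rule order_trans[OF sum_abs]) (simp add: abs_mult)
    also have "\<dots> \<le> (\<Sum>i<dim_col M. \<bar>M $$ (j, i)\<bar> * 1)"
      by (intro sum_mono mult_left_mono v1) auto
    finally show "\<bar>(M *\<^sub>v v) $ j\<bar> \<le> (\<Sum>i<dim_col M. \<bar>M $$ (j, i)\<bar>)" by simp
  qed
  finally show "l2_norm (M *\<^sub>v v) \<le> (\<Sum>j<dim_row M. \<Sum>i<dim_col M. \<bar>M $$ (j, i)\<bar>)" .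
qed

lemma l2_norm_eq_0_imp:
  assumes "l2_norm v = 0"
  shows "v = 0\<^sub>v (dim_vec v)"
proof (rule eq_vecI)
  fix i assume "i < dim_vec (0\<^sub>v (dim_vec v))"
  moreover have "\<forall>i\<in>{..<dim_vec v}. v $ i = 0"
    using assms L2_set_eq_0_iff[of "{..<dim_vec v}" "($) v"] by (simp add: l2_norm_eq[OF carrier_vec_dim_vec])
  ultimately show "v $ i = 0\<^sub>v (dim_vec v) $ i" by simp
qed simp

lemma mat_norm_nonneg: "0 \<le> mat_norm M"
proof -
  have "0 \<le> l2_norm (M *\<^sub>v 0\<^sub>v (dim_col M))" by (rule l2_norm_nonneg)
  also have "\<dots> \<le> mat_norm M"
    unfolding mat_norm_def by (rule cSUP_upper[OF _ bdd_above_mat_norm]) (simp add: l2_norm_def)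
  finally show ?thesis .
qed

lemma l2_norm_mult_mat_vec_le:
  assumes v: "v \<in> carrier_vec (dim_col M)"
  shows "l2_norm (M *\<^sub>v v) \<le> mat_norm M * l2_norm v"
proof (cases "l2_norm v = 0")
  case True
  then have v0: "v = 0\<^sub>v (dim_col M)" using l2_norm_eq_0_imp[of v] carrier_vecD[OF v] by simp
  have "M *\<^sub>v v = 0\<^sub>v (dim_row M)"
    unfolding v0 by (rule eq_vecI) auto
  then show ?thesis using True by (simp add: l2_norm_def)
next
  case False
  then have pos: "0 < l2_norm v" using l2_norm_nonneg[of v] by simp
  define u where "u = (1 / l2_norm v) \<cdot>\<^sub>v v"
  have u: "u \<in> carrier_vec (dim_col M)" "l2_norm u \<le> 1"
    using v pos by (simp_all add: u_def l2_norm_smult)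
  have vu: "v = l2_norm v \<cdot>\<^sub>v u"
    using pos by (simp add: u_def smult_smult_assoc)
  have "l2_norm (M *\<^sub>v u) \<le> mat_norm M"
    unfolding mat_norm_def by (rule cSUP_upper[OF _ bdd_above_mat_norm]) (use u in simp)
  moreover have "M *\<^sub>v v = l2_norm v \<cdot>\<^sub>v (M *\<^sub>v u)"
    by (subst vu) (rule mult_mat_vec[OF carrier_matI[OF refl refl] u(1)])
  then have "l2_norm (M *\<^sub>v v) = l2_norm v * l2_norm (M *\<^sub>v u)"
    using pos by (simp add: l2_norm_smult)
  ultimately show ?thesis
    using pos by (simp add: mult.commute)
qed

lemma l2_norm_power2: "(l2_norm v)\<^sup>2 = v \<bullet> v"
  unfolding l2_norm_def by (simp add: scalar_prod_def sum_nonneg)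

text \<open>With w = A v and L the norm of A A^T: |A^T w|^2 = w . (A A^T w) \<le> L |w|^2, and |w|^2
  = (A^T w) . v \<le> sqrt L |w| |v|. This is how that norm enters the time.\<close>

lemma l2_norm_mult_mat_vec_le_sqrt:
  assumes A: "A \<in> carrier_mat m n" and v: "v \<in> carrier_vec n"
  shows "l2_norm (A *\<^sub>v v) \<le> sqrt (mat_norm (A * A\<^sup>T)) * l2_norm v"
proof -
  define L where "L = mat_norm (A * A\<^sup>T)"
  define w where "w = A *\<^sub>v v"
  have L0: "0 \<le> L" unfolding L_def by (rule mat_norm_nonneg)
  have w: "w \<in> carrier_vec m" using A v by (simp add: w_def)
  have At: "A\<^sup>T \<in> carrier_mat n m" using A by simp
  have Atw: "A\<^sup>T *\<^sub>v w \<in> carrier_vec n" using At w by simp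
  have adj: "(A\<^sup>T *\<^sub>v w) \<bullet> u = w \<bullet> (A *\<^sub>v u)" if "u \<in> carrier_vec n" for u
    using transpose_vec_mult_scalar[OF A that w] by simp
  have "(l2_norm (A\<^sup>T *\<^sub>v w))\<^sup>2 = w \<bullet> (A *\<^sub>v (A\<^sup>T *\<^sub>v w))"
    unfolding l2_norm_power2 by (rule adj[OF Atw])
  also have "\<dots> = w \<bullet> ((A * A\<^sup>T) *\<^sub>v w)"
    using assoc_mult_mat_vec[OF A At w] by simp
  also have "\<dots> \<le> l2_norm w * l2_norm ((A * A\<^sup>T) *\<^sub>v w)"
    by (rule scalar_prod_le_l2_norm[OF w]) (use A w in auto)
  also have "\<dots> \<le> l2_norm w * (L * l2_norm w)"
    unfolding L_def
    by (intro mult_left_mono l2_norm_mult_mat_vec_le l2_norm_nonneg) (use A w in auto)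
  finally have "(l2_norm (A\<^sup>T *\<^sub>v w))\<^sup>2 \<le> (sqrt L * l2_norm w)\<^sup>2"
    using L0 by (simp add: power_mult_distrib power2_eq_square ac_simps)
  then have 1: "l2_norm (A\<^sup>T *\<^sub>v w) \<le> sqrt L * l2_norm w"
    by (rule power2_le_imp_le) (simp add: L0 l2_norm_nonneg)
  have "(l2_norm w)\<^sup>2 = (A\<^sup>T *\<^sub>v w) \<bullet> v"
    unfolding l2_norm_power2 adj[OF v] by (simp add: w_def)
  also have "\<dots> \<le> l2_norm (A\<^sup>T *\<^sub>v w) * l2_norm v"
    by (rule scalar_prod_le_l2_norm[OF Atw v])
  also have "\<dots> \<le> sqrt L * l2_norm w * l2_norm v"
    by (intro mult_right_mono 1 l2_norm_nonneg)
  finally have "l2_norm w * l2_norm w \<le> l2_norm w * (sqrt L * l2_norm v)"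
    by (simp add: power2_eq_square ac_simps)
  then have "l2_norm w \<le> sqrt L * l2_norm v"
    using l2_norm_nonneg[of w] l2_norm_nonneg[of v] L0
    by (cases "l2_norm w = 0") (auto simp: mult_le_cancel_left)
  then show ?thesis by (simp add: w_def L_def)
qed

text \<open>A maximal independent set of columns has \<open>m\<close> elements and so is a basis.
  Hence each unit vector is the image of some \<open>X k\<close>, and these are the columns of the
  inverse.\<close>

lemma full_rank_right_inverse:
  assumes A: "A \<in> carrier_mat m n" and rank: "vec_space.rank m A = m"
  obtains b where "\<And>w j. j < m \<Longrightarrow> mat_app n (\<lambda>j i. A $$ (j, i)) (mat_app m b w) j = (w j :: real)"
proof -
  interpret vec_space "TYPE(real)" m .
  have cols: "set (cols A) \<subseteq> carrier_vec m" using cols_dim[of A] A by auto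
  have "lin_indpt {}" by (auto simp: lin_dep_def)
  then obtain U where U: "finite U" "maximal U (\<lambda>T. T \<subseteq> set (cols A) \<and> lin_indpt T)"
    using maximal_exists_superset[of "set (cols A)" "\<lambda>T. T \<subseteq> set (cols A) \<and> lin_indpt T" "{}"] by auto
  then have Us: "U \<subseteq> set (cols A)" "lin_indpt U" by (auto simp: maximal_def)
  have "card U = m" using rank_card_indpt[OF A U(2)] rank by simp
  then have "basis U"
    using U(1) Us cols by (intro dim_li_is_basis fin_dim) (auto simp: dim_is_n)
  then have "span U = carrier_vec m" by (simp add: basis_def)
  then have "carrier_vec m \<subseteq> col_space A"
    using span_is_monotone[OF Us(1)] by (simp add: col_space_def)
  then have "unit_vec m k \<in> col_space A" for k by (rule subsetD) simp
  then have "\<exists>x\<in>carrier_vec n. A *\<^sub>v x = unit_vec m k" for k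
    unfolding col_space_eq[OF A] carrier_matD[OF A] by blast
  then obtain X where X: "\<And>k. X k \<in> carrier_vec n" "\<And>k. A *\<^sub>v X k = unit_vec m k"
    by metis
  have "mat_app n (\<lambda>j i. A $$ (j, i)) (mat_app m (\<lambda>i k. X k $ i) w) j = w j" if j: "j < m" for w j
  proof -
    have "mat_app n (\<lambda>j i. A $$ (j, i)) (mat_app m (\<lambda>i k. X k $ i) w) j
        = (\<Sum>i<n. \<Sum>k<m. w k * (A $$ (j, i) * X k $ i))"
      by (simp add: mat_app_def sum_distrib_left ac_simps)
    also have "\<dots> = (\<Sum>k<m. w k * mat_app n (\<lambda>j i. A $$ (j, i)) (($) (X k)) j)"
      by (subst sum.swap) (simp add: mat_app_def sum_distrib_left)
    also have "\<dots> = (\<Sum>k<m. w k * unit_vec m k $ j)"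
      by (simp add: mult_mat_vec_eq_mat_app[OF A X(1) j, symmetric] X(2))
    also have "\<dots> = (\<Sum>k<m. if k = j then w k else 0)"
      by (rule sum.cong) (use j in auto)
    also have "\<dots> = w j" using j by simp
    finally show ?thesis .
  qed
  then show thesis by (rule that)
qed

section \<open>From strong solutions to the coordinate form of the flow\<close>

lemma negligible_if_AE_lebesgue_on:
  assumes "AE t in lebesgue_on S. P t" "S \<in> sets lebesgue"
  shows "negligible {t \<in> S. \<not> P t}"
proof -
  have "AE t in lebesgue. t \<in> S \<longrightarrow> P t"
    using assms by (simp add: AE_restrict_space_iff)
  then obtain N where N: "N \<in> null_sets lebesgue" "{t \<in> space lebesgue. \<not> (t \<in> S \<longrightarrow> P t)} \<subseteq> N"
    unfolding eventually_ae_filter by blast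
  have "{t \<in> S. \<not> P t} \<subseteq> N"
  proof
    fix t assume "t \<in> {t \<in> S. \<not> P t}"
    then have "t \<in> {t \<in> space lebesgue. \<not> (t \<in> S \<longrightarrow> P t)}" by simp
    then show "t \<in> N" using N(2) by (rule subsetD[rotated])
  qed
  moreover have "negligible N" using N(1) by (simp add: negligible_iff_null_sets)
  ultimately show ?thesis by (rule negligible_subset[rotated])
qed

lemma strong_solution_l1_flow:
  assumes A: "A \<in> carrier_mat m n" and y: "y \<in> carrier_vec m" and tau: "0 < \<tau>"
    and sol: "\<And>T'. 0 < T' \<Longrightarrow> strong_solution_on A y \<tau> x0 x z T'"
  obtains x' p N where "l1_flow n m (\<lambda>j i. A $$ (j, i)) (($) y) \<tau> (\<lambda>t. ($) (x t)) (\<lambda>t. ($) (z t)) x' p N"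
proof -
  define G where "G t x' p \<longleftrightarrow> x' \<in> carrier_vec n \<and> p \<in> subdiff_l1 (x t) \<and> has_vec_derivative x x' t \<and>
      has_vec_derivative z (y - A *\<^sub>v x t) t \<and>
      x' - A\<^sup>T *\<^sub>v (z t - A *\<^sub>v x t + y) = (- \<tau>) \<cdot>\<^sub>v p" for t x' p
  define N where "N = {t. 0 \<le> t \<and> \<not> (\<exists>x' p. G t x' p)}"
  have dims: "dim_col A = n" "dim_row A = m" using A by auto
  \<comment> \<open>Solutions are given on one bounded interval at a time. Those up to
    \<open>real k + 1\<close>, of positive length also for k = 0, exhaust the half-line, and their
    exceptional sets combine into a single null set.\<close>
  have neg: "negligible {t \<in> {0..real k + 1}. \<not> (\<exists>x' p. G t x' p)}" for k
  proof (rule negligible_if_AE_lebesgue_on)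
    have "strong_solution_on A y \<tau> x0 x z (real k + 1)" by (rule sol) simp
    then have "AE t in lebesgue_on {0..real k + 1}. \<exists>x' \<in> carrier_vec n. \<exists>z' \<in> carrier_vec m.
        has_vec_derivative x x' t \<and> has_vec_derivative z z' t \<and>
        x' - A\<^sup>T *\<^sub>v (z t - A *\<^sub>v x t + y) \<in> {(-\<tau>) \<cdot>\<^sub>v p |p. p \<in> subdiff_l1 (x t)} \<and>
        z' = y - A *\<^sub>v x t"
      unfolding strong_solution_on_def dims by blast
    then show "AE t in lebesgue_on {0..real k + 1}. \<exists>x' p. G t x' p"
      by (rule AE_mp) (rule AE_I2, auto simp: G_def)
  qed simp
  have "N = (\<Union>k. {t \<in> {0..real k + 1}. \<not> (\<exists>x' p. G t x' p)})"
  proof -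
    have "\<exists>k. t \<le> real k + 1" for t :: real
      using real_arch_simple[of t] by (meson add_increasing2 order_trans zero_le_one)
    then show ?thesis by (auto simp: N_def)
  qed
  then have N: "negligible N" using neg by (auto intro: negligible_countable_Union)
  have "\<exists>x' p. G t x' p" if "0 < t" "t \<notin> N" for t
    using that by (auto simp: N_def)
  then obtain X' P where XP: "\<And>t. 0 < t \<Longrightarrow> t \<notin> N \<Longrightarrow> G t (X' t) (P t)" by metis
  have carr: "x t \<in> carrier_vec n" "z t \<in> carrier_vec m" if "0 < t" for t
    using sol[OF that] that unfolding strong_solution_on_def continuous_vec_on_def dims by auto
  have "l1_flow n m (\<lambda>j i. A $$ (j, i)) (($) y) \<tau> (\<lambda>t. ($) (x t)) (\<lambda>t. ($) (z t))
      (\<lambda>t. ($) (X' t)) (\<lambda>t. ($) (P t)) N"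
  proof
    show "0 < \<tau>" by (rule tau)
    show "negligible N" by (rule N)
    show "abs_continuous_on {0..b} (\<lambda>t. x t $ i)" if "i < n" "0 < b" for i b
      using sol[OF that(2)] that(1) unfolding strong_solution_on_def abs_continuous_vec_on_def dims by blast
    show "abs_continuous_on {0..b} (\<lambda>t. z t $ j)" if "j < m" "0 < b" for j b
      using sol[OF that(2)] that(1) unfolding strong_solution_on_def abs_continuous_vec_on_def dims by blast
    show "z 0 $ j = 0" if "j < m" for j
      using sol[of 1] that unfolding strong_solution_on_def dims by simp
    fix t :: real assume t: "0 < t" "t \<notin> N"
    note x = carr(1)[OF t(1)] and z = carr(2)[OF t(1)]
    note g = XP[OF t, unfolded G_def]
    have Ax: "A *\<^sub>v x t \<in> carrier_vec m" using A x by simp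
    have Pd: "P t \<in> carrier_vec n" and Pi: "\<And>i. i < n \<Longrightarrow> P t $ i \<in> sgn_set (x t $ i)"
      using g carrier_vecD[OF x] by (auto simp: subdiff_l1_def)
    show "((\<lambda>s. x s $ i) has_real_derivative X' t $ i) (at t)" if "i < n" for i
      using g that carrier_vecD[of "X' t" n] by (auto simp: has_vec_derivative_def)
    show "((\<lambda>s. z s $ j) has_real_derivative y $ j - mat_app n (\<lambda>j i. A $$ (j, i)) (($) (x t)) j) (at t)"
      if "j < m" for j
    proof -
      have "((\<lambda>s. z s $ j) has_real_derivative (y - A *\<^sub>v x t) $ j) (at t)"
        using g that dims unfolding has_vec_derivative_def by simp
      moreover have "(y - A *\<^sub>v x t) $ j = y $ j - mat_app n (\<lambda>j i. A $$ (j, i)) (($) (x t)) j"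
        unfolding mult_mat_vec_eq_mat_app[OF A x that, symmetric] using that dims by simp
      ultimately show ?thesis by simp
    qed
    show "P t $ i \<in> sgn_set (x t $ i)" if "i < n" for i by (rule Pi[OF that])
    show "X' t $ i = (\<Sum>j<m. A $$ (j, i) * (z t $ j - mat_app n (\<lambda>j i. A $$ (j, i)) (($) (x t)) j + y $ j))
        - \<tau> * P t $ i" if i: "i < n" for i
    proof -
      have w: "z t - A *\<^sub>v x t + y \<in> carrier_vec m"
        by (rule add_carrier_vec[OF minus_carrier_vec[OF z Ax] y])
      have "(X' t - A\<^sup>T *\<^sub>v (z t - A *\<^sub>v x t + y)) $ i = ((- \<tau>) \<cdot>\<^sub>v P t) $ i" using g by simp
      then have "X' t $ i - (A\<^sup>T *\<^sub>v (z t - A *\<^sub>v x t + y)) $ i = - \<tau> * P t $ i"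
        using i dims carrier_vecD[OF Pd] by simp
      also have "(A\<^sup>T *\<^sub>v (z t - A *\<^sub>v x t + y)) $ i = (\<Sum>j<m. A $$ (j, i) * (z t - A *\<^sub>v x t + y) $ j)"
        by (rule transpose_mult_mat_vec_index[OF A w i])
      also have "\<dots> = (\<Sum>j<m. A $$ (j, i) * (z t $ j - mat_app n (\<lambda>j i. A $$ (j, i)) (($) (x t)) j + y $ j))"
      proof (rule sum.cong[OF refl])
        fix j assume "j \<in> {..<m}"
        then show "A $$ (j, i) * (z t - A *\<^sub>v x t + y) $ j
            = A $$ (j, i) * (z t $ j - mat_app n (\<lambda>j i. A $$ (j, i)) (($) (x t)) j + y $ j)"
          using carrier_vecD[OF y] dims mult_mat_vec_eq_mat_app[OF A x, of j] by simp
      qed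
      finally show ?thesis by simp
    qed
  qed
  then show thesis by (rule that)
qed

section \<open>Norms, minimality and the gap in coordinates\<close>

lemma l2_norm_residual_eq:
  assumes "A \<in> carrier_mat m n" "v \<in> carrier_vec n" "y \<in> carrier_vec m"
  shows "l2_norm (A *\<^sub>v v - y) = L2_set (\<lambda>j. mat_app n (\<lambda>j i. A $$ (j, i)) (($) v) j - y $ j) {..<m}"
proof -
  have c: "A *\<^sub>v v - y \<in> carrier_vec m"
    by (rule minus_carrier_vec[OF mult_mat_vec_carrier[OF assms(1,2)] assms(3)])
  show ?thesis
    unfolding l2_norm_eq[OF c]
    by (rule L2_set_cong[OF refl])
      (use assms mult_mat_vec_eq_mat_app[OF assms(1,2)] in simp)
qed

lemma l2_norm_diff_eq:
  assumes "u \<in> carrier_vec n" "v \<in> carrier_vec n"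
  shows "l2_norm (u - v) = L2_set (\<lambda>i. u $ i - v $ i) {..<n}"
  unfolding l2_norm_eq[OF minus_carrier_vec[OF assms]]
  by (rule L2_set_cong[OF refl]) (use assms in simp)

text \<open>\<open>uniqueness_gap\<close> and minimality speak of vectors, the coordinate lemmas
  quantify over functions; these equations pass from one to the other.\<close>

lemma fun_as_vec:
  fixes f :: "nat \<Rightarrow> real"
  assumes A: "A \<in> carrier_mat m n" and y: "y \<in> carrier_vec m" and xb: "xb \<in> carrier_vec n"
  shows "l1_norm (Matrix.vec n f) = (\<Sum>i<n. \<bar>f i\<bar>)"
    and "l2_norm (A *\<^sub>v Matrix.vec n f - y) = L2_set (\<lambda>j. mat_app n (\<lambda>j i. A $$ (j, i)) f j - y $ j) {..<m}"
    and "l2_norm (Matrix.vec n f - xb) = L2_set (\<lambda>i. f i - xb $ i) {..<n}"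
proof -
  have c: "Matrix.vec n f \<in> carrier_vec n" by simp
  show "l1_norm (Matrix.vec n f) = (\<Sum>i<n. \<bar>f i\<bar>)" by (simp add: l1_norm_eq[OF c])
  have "mat_app n (\<lambda>j i. A $$ (j, i)) (($) (Matrix.vec n f)) j = mat_app n (\<lambda>j i. A $$ (j, i)) f j" for j
    by (rule mat_app_cong) simp
  then show "l2_norm (A *\<^sub>v Matrix.vec n f - y) = L2_set (\<lambda>j. mat_app n (\<lambda>j i. A $$ (j, i)) f j - y $ j) {..<m}"
    unfolding l2_norm_residual_eq[OF A c y] by simp
  show "l2_norm (Matrix.vec n f - xb) = L2_set (\<lambda>i. f i - xb $ i) {..<n}"
    unfolding l2_norm_diff_eq[OF c xb] by (rule L2_set_cong) auto
qed

lemma unique_l1_minimizerD: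
  assumes A: "A \<in> carrier_mat m n" and u: "unique_l1_minimizer A y xb"
  shows "xb \<in> carrier_vec n" "A *\<^sub>v xb = y"
    "\<And>v. v \<in> carrier_vec n \<Longrightarrow> A *\<^sub>v v = y \<Longrightarrow> l1_norm xb \<le> l1_norm v"
    "\<And>v. v \<in> carrier_vec n \<Longrightarrow> A *\<^sub>v v = y \<Longrightarrow> l1_norm v \<le> l1_norm xb \<Longrightarrow> v = xb"
proof -
  let ?P = "\<lambda>v. v \<in> carrier_vec n \<and> A *\<^sub>v v = y"
  have iff: "is_arg_min l1_norm ?P v \<longleftrightarrow> v = xb" for v
    using u carrier_matD[OF A] unfolding unique_l1_minimizer_def by simp
  then have am: "is_arg_min l1_norm ?P xb" by simp
  then show "xb \<in> carrier_vec n" "A *\<^sub>v xb = y" by (auto simp: is_arg_min_def)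
  show le: "l1_norm xb \<le> l1_norm v" if "v \<in> carrier_vec n" "A *\<^sub>v v = y" for v
    using am that unfolding is_arg_min_linorder by blast
  show "v = xb" if "v \<in> carrier_vec n" "A *\<^sub>v v = y" "l1_norm v \<le> l1_norm xb" for v
  proof -
    have "is_arg_min l1_norm ?P v"
      unfolding is_arg_min_linorder using that le by (meson order_trans)
    then show ?thesis by (simp add: iff)
  qed
qed

lemma uniqueness_gap_exists_vec:
  assumes A: "A \<in> carrier_mat m n" and rank: "vec_space.rank m A = m" and y: "y \<in> carrier_vec m"
    and u: "unique_l1_minimizer A y xb" and \<delta>: "0 < \<delta>"
  shows "\<exists>\<rho> \<kappa>. uniqueness_gap A y xb \<delta> \<rho> \<kappa>"
proof -
  note u = unique_l1_minimizerD[OF A u]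
  note f = fun_as_vec[OF A y u(1)]
  let ?a = "\<lambda>j i. A $$ (j, i)"
  have feas: "A *\<^sub>v Matrix.vec n v = y" if "\<And>j. j < m \<Longrightarrow> mat_app n ?a v j = y $ j" for v
  proof (rule eq_vecI)
    fix j assume "j < dim_vec y"
    then have j: "j < m" using y by simp
    have "(A *\<^sub>v Matrix.vec n v) $ j = mat_app n ?a (($) (Matrix.vec n v)) j"
      by (rule mult_mat_vec_eq_mat_app[OF A _ j]) simp
    also have "\<dots> = mat_app n ?a v j" by (rule mat_app_cong) simp
    finally show "(A *\<^sub>v Matrix.vec n v) $ j = y $ j" using that[OF j] by simp
  qed (use A y in simp)
  obtain b where "\<forall>w j. j < m \<longrightarrow> mat_app n ?a (mat_app m b w) j = w j"
    by (rule full_rank_right_inverse[OF A rank]) blast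
  then have b: "mat_app n ?a (mat_app m b w) j = w j" if "j < m" for w j
    using that by blast
  have l1: "l1_norm xb = (\<Sum>i<n. \<bar>xb $ i\<bar>)" by (rule l1_norm_eq[OF u(1)])
  have min: "(\<Sum>i<n. \<bar>xb $ i\<bar>) \<le> (\<Sum>i<n. \<bar>v i\<bar>)"
    if "\<And>j. j < m \<Longrightarrow> mat_app n ?a v j = y $ j" for v
    using u(3)[OF _ feas[OF that]] by (simp add: f l1)
  obtain \<rho> where \<rho>: "0 \<le> \<rho>" "\<forall>v. (\<Sum>i<n. \<bar>xb $ i\<bar>) \<le> (\<Sum>i<n. \<bar>v i\<bar>)
      + \<rho> * L2_set (\<lambda>j. mat_app n ?a v j - y $ j) {..<m}"
    by (rule exact_penalty_exists[of m n ?a b "($) y" "($) xb", OF b min]) blast+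
  have uniq: "v i = xb $ i" if "\<And>j. j < m \<Longrightarrow> mat_app n ?a v j = y $ j"
    "(\<Sum>i<n. \<bar>v i\<bar>) \<le> (\<Sum>i<n. \<bar>xb $ i\<bar>)" "i < n" for v i
  proof -
    have "Matrix.vec n v = xb"
    proof (rule u(4))
      show "A *\<^sub>v Matrix.vec n v = y" by (rule feas[OF that(1)])
      show "l1_norm (Matrix.vec n v) \<le> l1_norm xb" unfolding f(1) l1 by (rule that(2))
    qed simp
    then show ?thesis using that(3) by (metis index_vec)
  qed
  have "\<exists>\<kappa>>0. \<forall>v. \<delta> \<le> L2_set (\<lambda>i. v i - xb $ i) {..<n} \<longrightarrow>
    (\<Sum>i<n. \<bar>xb $ i\<bar>) + \<kappa> \<le> (\<Sum>i<n. \<bar>v i\<bar>) + (\<rho> + 1) * L2_set (\<lambda>j. mat_app n ?a v j - y $ j) {..<m}"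
  proof (rule uniqueness_gap_exists[where n = n and xb = "($) xb" and m = m and a = ?a and y = "($) y",
        OF \<rho>(1) \<delta>])
    show "(\<Sum>i<n. \<bar>xb $ i\<bar>) \<le> (\<Sum>i<n. \<bar>v i\<bar>) + \<rho> * L2_set (\<lambda>j. mat_app n ?a v j - y $ j) {..<m}" for v
      by (rule spec[OF \<rho>(2)])
    show "v i = xb $ i" if "\<And>j. j < m \<Longrightarrow> mat_app n ?a v j = y $ j"
      "(\<Sum>i<n. \<bar>v i\<bar>) \<le> (\<Sum>i<n. \<bar>xb $ i\<bar>)" "i < n" for v i
      by (rule uniq[OF that])
  qed blast
  then obtain \<kappa> where \<kappa>: "0 < \<kappa>" "\<forall>v. \<delta> \<le> L2_set (\<lambda>i. v i - xb $ i) {..<n} \<longrightarrow>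
    (\<Sum>i<n. \<bar>xb $ i\<bar>) + \<kappa> \<le> (\<Sum>i<n. \<bar>v i\<bar>) + (\<rho> + 1) * L2_set (\<lambda>j. mat_app n ?a v j - y $ j) {..<m}"
    by blast
  have "uniqueness_gap A y xb \<delta> (\<rho> + 1) \<kappa>"
    unfolding uniqueness_gap_def carrier_matD[OF A]
  proof (intro conjI ballI impI \<kappa>(1))
    fix v :: "real Matrix.vec" assume v: "v \<in> carrier_vec n"
    note eqs = l1_norm_eq[OF v] l1 l2_norm_residual_eq[OF A v y] l2_norm_diff_eq[OF v u(1)]
    have "\<rho> * L2_set (\<lambda>j. mat_app n ?a (($) v) j - y $ j) {..<m}
        \<le> (\<rho> + 1) * L2_set (\<lambda>j. mat_app n ?a (($) v) j - y $ j) {..<m}"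
      by (rule mult_right_mono) auto
    then show "l1_norm xb \<le> l1_norm v + (\<rho> + 1) * l2_norm (A *\<^sub>v v - y)"
      unfolding eqs using spec[OF \<rho>(2), of "($) v"] by linarith
    show "l1_norm xb + \<kappa> \<le> l1_norm v + (\<rho> + 1) * l2_norm (A *\<^sub>v v - y)" if "\<delta> \<le> l2_norm (v - xb)"
      using that unfolding eqs by (rule \<kappa>(2)[rule_format])
  qed
  then show ?thesis by blast
qed

lemma strong_solution_settles:
  assumes A: "A \<in> carrier_mat m n" and y: "y \<in> carrier_vec m" and tau: "0 < \<tau>" and x0: "x0 \<in> carrier_vec n"
    and u: "unique_l1_minimizer A y xb"
    and sol: "\<And>T'. 0 < T' \<Longrightarrow> strong_solution_on A y \<tau> x0 x z T'"
    and gap: "uniqueness_gap A y xb \<delta> \<rho> \<kappa>"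
    and t: "settling_time (l1_norm x0) (mat_norm (A * A\<^sup>T)) \<tau> (l2_norm y) \<bar>\<rho>\<bar> \<kappa> < t"
  shows "l2_norm (x t - xb) < \<delta>"
proof -
  note u = unique_l1_minimizerD[OF A u]
  note f = fun_as_vec[OF A y u(1)]
  let ?a = "\<lambda>j i. A $$ (j, i)"
  have l1: "l1_norm xb = (\<Sum>i<n. \<bar>xb $ i\<bar>)" by (rule l1_norm_eq[OF u(1)])
  obtain x' p N where "l1_flow n m ?a (($) y) \<tau> (\<lambda>t. ($) (x t)) (\<lambda>t. ($) (z t)) x' p N"
    by (rule strong_solution_l1_flow[OF A y tau sol])
  then interpret l1_flow n m ?a "($) y" \<tau> "\<lambda>t. ($) (x t)" "\<lambda>t. ($) (z t)" x' p N .
  have \<kappa>: "0 < \<kappa>" using gap by (simp add: uniqueness_gap_def)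
  \<comment> \<open>\<open>uniqueness_gap\<close> leaves the sign of \<rho> open, while the
    certificate lives in a ball of radius at least 0; raising the penalty to |\<rho>| keeps both
    inequalities.\<close>
  have weaken: "c \<le> d + \<bar>\<rho>\<bar> * L2_set g {..<m}" if "c \<le> d + \<rho> * L2_set g {..<m}" for c d g
    using that mult_right_mono[OF abs_ge_self[of \<rho>], of "L2_set g {..<m}"] by simp
  have "0 \<le> settling_time (l1_norm x0) (mat_norm (A * A\<^sup>T)) \<tau> (l2_norm y) \<bar>\<rho>\<bar> \<kappa>"
    by (simp add: settling_time_def)
  with t have t0: "0 < t" by linarith
  have "x 0 = x0" using sol[of 1] by (simp add: strong_solution_on_def)
  have xt: "x t \<in> carrier_vec n"
    using sol[OF t0] t0 carrier_matD[OF A] by (auto simp: strong_solution_on_def continuous_vec_on_def)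
  have "L2_set (\<lambda>i. x t $ i - xb $ i) {..<n} < \<delta>"
  proof (rule convergence[where \<rho> = "\<bar>\<rho>\<bar>" and \<kappa> = \<kappa> and L = "mat_norm (A * A\<^sup>T)"])
    show "mat_app n ?a (($) xb) j = y $ j" if "j < m" for j
      using mult_mat_vec_eq_mat_app[OF A u(1) that] u(2) by simp
    show "0 < \<kappa>" by (rule \<kappa>)
    show "0 \<le> mat_norm (A * A\<^sup>T)" by (rule mat_norm_nonneg)
    fix v
    have "l1_norm xb \<le> l1_norm (Matrix.vec n v) + \<rho> * l2_norm (A *\<^sub>v Matrix.vec n v - y)"
      using gap carrier_matD[OF A] unfolding uniqueness_gap_def by simp
    then show "(\<Sum>i<n. \<bar>xb $ i\<bar>) \<le> (\<Sum>i<n. \<bar>v i\<bar>) + \<bar>\<rho>\<bar> * L2_set (\<lambda>j. mat_app n ?a v j - y $ j) {..<m}"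
      unfolding f l1 by (rule weaken)
    assume "\<delta> \<le> L2_set (\<lambda>i. v i - xb $ i) {..<n}"
    then have "l1_norm xb + \<kappa> \<le> l1_norm (Matrix.vec n v) + \<rho> * l2_norm (A *\<^sub>v Matrix.vec n v - y)"
      using gap carrier_matD[OF A] unfolding uniqueness_gap_def by (simp add: f(3))
    then show "(\<Sum>i<n. \<bar>xb $ i\<bar>) + \<kappa> \<le> (\<Sum>i<n. \<bar>v i\<bar>) + \<bar>\<rho>\<bar> * L2_set (\<lambda>j. mat_app n ?a v j - y $ j) {..<m}"
      unfolding f l1 by (rule weaken)
  next
    have "l2_norm (A *\<^sub>v x0) = L2_set (mat_app n ?a (($) x0)) {..<m}"
      unfolding l2_norm_eq[OF mult_mat_vec_carrier[OF A x0]]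
      by (rule L2_set_cong[OF refl]) (simp add: mult_mat_vec_eq_mat_app[OF A x0])
    then show "L2_set (mat_app n ?a (($) (x 0))) {..<m} \<le> sqrt (mat_norm (A * A\<^sup>T)) * L2_set (($) (x 0)) {..<n}"
      using l2_norm_mult_mat_vec_le_sqrt[OF A x0] unfolding \<open>x 0 = x0\<close> l2_norm_eq[OF x0] by simp
    show "settling_time (\<Sum>i<n. \<bar>x 0 $ i\<bar>) (mat_norm (A * A\<^sup>T)) \<tau> (L2_set (($) y) {..<m}) \<bar>\<rho>\<bar> \<kappa> < t"
      using t unfolding \<open>x 0 = x0\<close> l1_norm_eq[OF x0] l2_norm_eq[OF y] .
  qed simp
  then show ?thesis unfolding l2_norm_diff_eq[OF xt u(1)] .
qed

text \<open>Independence of the dimension is expressed by the order of quantifiers: \<open>T\<close>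
  is chosen before \<open>m\<close> and \<open>n\<close>. The middle conjunct guarantees that the
  last one applies for every \<delta>, and together they give the first.\<close>

theorem theorem2p4:
  shows "\<exists>T :: real \<Rightarrow> real \<Rightarrow> real \<Rightarrow> real \<Rightarrow> real \<Rightarrow> real \<Rightarrow> real \<Rightarrow> real.
    \<forall>(m::nat) (n::nat) (A::real mat) (y::real vec) (\<tau>::real) (x0::real vec) (xbar::real vec)
      (x::real \<Rightarrow> real vec) (z::real \<Rightarrow> real vec).
      0 < m \<and> m < n \<and> A \<in> carrier_mat m n \<and> vec_space.rank m A = m \<and>
      y \<in> carrier_vec m \<and> 0 < \<tau> \<and> x0 \<in> carrier_vec n \<and>
      unique_l1_minimizer A y xbar \<and>
      (\<forall>T'>0. strong_solution_on A y \<tau> x0 x z T')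
      \<longrightarrow>
      (\<forall>\<delta>>0. \<exists>T\<^sub>\<delta>. \<forall>t>T\<^sub>\<delta>. l2_norm (x t - xbar) < \<delta>) \<and>
      (\<forall>\<delta>>0. \<exists>\<rho> \<kappa>. uniqueness_gap A y xbar \<delta> \<rho> \<kappa>) \<and>
      (\<forall>\<delta>>0. \<forall>\<rho> \<kappa>. uniqueness_gap A y xbar \<delta> \<rho> \<kappa> \<longrightarrow>
         (\<forall>t > T \<delta> (l1_norm x0) (mat_norm (A * A\<^sup>T)) \<tau> (l2_norm y) \<rho> \<kappa>.
            l2_norm (x t - xbar) < \<delta>))"
proof (rule exI[of _ "\<lambda>\<delta> \<alpha> L \<tau> \<beta> \<rho> \<kappa>. settling_time \<alpha> L \<tau> \<beta> \<bar>\<rho>\<bar> \<kappa>"], intro allI impI)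
  fix m n :: nat and A :: "real mat" and y :: "real vec" and \<tau> :: real and x0 xbar :: "real vec"
    and x z :: "real \<Rightarrow> real vec"
  assume H: "0 < m \<and> m < n \<and> A \<in> carrier_mat m n \<and> vec_space.rank m A = m \<and>
      y \<in> carrier_vec m \<and> 0 < \<tau> \<and> x0 \<in> carrier_vec n \<and>
      unique_l1_minimizer A y xbar \<and>
      (\<forall>T'>0. strong_solution_on A y \<tau> x0 x z T')"
  then have A: "A \<in> carrier_mat m n" and rank: "vec_space.rank m A = m" and y: "y \<in> carrier_vec m"
    and tau: "0 < \<tau>" and x0: "x0 \<in> carrier_vec n" and u: "unique_l1_minimizer A y xbar"
    and sol: "\<And>T'. 0 < T' \<Longrightarrow> strong_solution_on A y \<tau> x0 x z T'"
    by blast+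
  have gap: "\<exists>\<rho> \<kappa>. uniqueness_gap A y xbar \<delta> \<rho> \<kappa>" if "0 < \<delta>" for \<delta>
    by (rule uniqueness_gap_exists_vec[OF A rank y u that])
  have settles: "l2_norm (x t - xbar) < \<delta>" if "uniqueness_gap A y xbar \<delta> \<rho> \<kappa>"
    "settling_time (l1_norm x0) (mat_norm (A * A\<^sup>T)) \<tau> (l2_norm y) \<bar>\<rho>\<bar> \<kappa> < t" for \<delta> \<rho> \<kappa> t
    by (rule strong_solution_settles[OF A y tau x0 u sol that])
  show "(\<forall>\<delta>>0. \<exists>T\<^sub>\<delta>. \<forall>t>T\<^sub>\<delta>. l2_norm (x t - xbar) < \<delta>) \<and>
      (\<forall>\<delta>>0. \<exists>\<rho> \<kappa>. uniqueness_gap A y xbar \<delta> \<rho> \<kappa>) \<and>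
      (\<forall>\<delta>>0. \<forall>\<rho> \<kappa>. uniqueness_gap A y xbar \<delta> \<rho> \<kappa> \<longrightarrow>
         (\<forall>t > settling_time (l1_norm x0) (mat_norm (A * A\<^sup>T)) \<tau> (l2_norm y) \<bar>\<rho>\<bar> \<kappa>.
            l2_norm (x t - xbar) < \<delta>))"
    using gap settles by meson
qed

end
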